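(* Let $F_\varepsilon$ be an analytic (or $C^\infty$, or formal) family of area-preserving orientation-reversing maps defined in a neighbourhood of the origin of $\mathbb{R}^2$ such that $F_0(0)=0$ and $DF_0(0)$ has eigenvalues $-1$ and $1$. Let $D=\mathrm{diag}(-1,1)$, i.e. $D(x,y)=(-x,y)$. Assume that the leading order of the normal form is non-degenerate, that is: there are a canonical formal change of variables $\psi_\varepsilon$ and a formal Hamiltonian $g_\varepsilon(x,y)=\sum_{k+l+3m\ge3}g_{klm}x^ky^l\varepsilon^m$, odd in $x$, such that $F_\varepsilon=\psi_\varepsilon^{-1}\circ(D\circ\Phi^1_{g_\varepsilon})\circ\psi_\varepsilon$ and such that the cubic part of $g_0$ is $b\,xy^2+c\,x^3$ with $b\ne0$. Then there exists a canonical formal change of variables $\phi_\varepsilon$ such that $$F_\varepsilon=\phi_\varepsilon^{-1}\circ\bigl(D\circ\Phi^1_{h_\varepsilon}\bigr)\circ\phi_\varepsilon,$$ where $$h_\varepsilon(x,y)=xy^2+ax^3+A(x,\varepsilon)+y\,B(xy^2,\varepsilon),$$ $a\in\mathbb{R}$, and $A$, $B$ are formal series of the form $$A(x,\varepsilon)=\sum_{\substack{k\ge1,\ m\ge0\\ (2k-1)+3m\ge4}}a_{mk}x^{2k-1}\varepsilon^m,\qquad B(xy^2,\varepsilon)=\sum_{k\ge1,\ m\ge0}b_{mk}(xy^2)^{2k-1}\varepsilon^m .$$ The coefficients of the series are defined uniquely by the family $F_\varepsilon$: any two canonical formal changes of variables bringing $F_\varepsilon$ to this form give the same $h_\vareps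ilon$.
   Context: A family $F_\varepsilon$ is analytic (resp. $C^\infty$, formal) jointly in $(x,y,\varepsilon)$ and is identified with its Taylor series at $(x,y,\varepsilon)=(0,0,0)$; all conjugacy identities are identities of formal power series with real coefficients. Area-preserving and orientation-reversing means that the Jacobian determinant with respect to $(x,y)$ is identically $-1$. A canonical formal change of variables is a pair $\phi_\varepsilon$ of formal power series in $(x,y,\varepsilon)$ with $\phi_0(0,0)=(0,0)$ whose Jacobian determinant with respect to $(x,y)$ is identically $1$. Compositions are in $(x,y)$, with $\varepsilon$ as a parameter. For formal series, $\{f,g\}=\partial_xf\,\partial_yg-\partial_yf\,\partial_xg$ and $L_\chi g=\{g,\chi\}$. The formal time-one map of $\chi$ is $\Phi^1_\chi(x,y)=(\exp(L_\chi)x,\exp(L_\chi)y)$, $\exp(L_\chi)g=\sum_{k\ge0}\frac1{k!}L_\chi^kg$. Here it is well defined coefficientwise because, assigning orders $1,1,3$ to $x,y,\varepsilon$, the Hamiltonians contain only monomials of order at least $3$. A series is odd in $x$ if it changes sign under $x\mapsto-x$. *)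

theory Defs
  imports "HOL-Analysis.Analysis" "HOL-Computational_Algebra.Formal_Power_Series"
begin

(* Real formal power series in x, y, eps: the outermost fps variable is eps, the middle one is y,
   the innermost one is x. *)
type_synonym series = "real fps fps fps"

type_synonym fmap = "series \<times> series"

(* coefficient of x^k y^l eps^m *)
definition cf :: "series \<Rightarrow> nat \<Rightarrow> nat \<Rightarrow> nat \<Rightarrow> real" where
  "cf f k l m = fps_nth (fps_nth (fps_nth f m) l) k"

definition mk_series :: "(nat \<Rightarrow> nat \<Rightarrow> nat \<Rightarrow> real) \<Rightarrow> series" where
  "mk_series c = Abs_fps (\<lambda>m. Abs_fps (\<lambda>l. Abs_fps (\<lambda>k. c k l m)))"

definition sconst :: "real \<Rightarrow> series" where
  "sconst r = fps_const (fps_const (fps_const r))"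

definition sX :: series where "sX = fps_const (fps_const fps_X)"
definition sY :: series where "sY = fps_const fps_X"
definition sE :: series where "sE = fps_X"

definition pd_x :: "series \<Rightarrow> series" where
  "pd_x f = Abs_fps (\<lambda>m. Abs_fps (\<lambda>l. fps_deriv (fps_nth (fps_nth f m) l)))"

definition pd_y :: "series \<Rightarrow> series" where
  "pd_y f = Abs_fps (\<lambda>m. fps_deriv (fps_nth f m))"

definition poisson :: "series \<Rightarrow> series \<Rightarrow> series" where
  "poisson f g = pd_x f * pd_y g - pd_y f * pd_x g"

definition jac :: "fmap \<Rightarrow> series" where
  "jac F = pd_x (fst F) * pd_y (snd F) - pd_y (fst F) * pd_x (snd F)"

definition fixes_origin :: "fmap \<Rightarrow> bool" where
  "fixes_origin F \<longleftrightarrow> cf (fst F) 0 0 0 = 0 \<and> cf (snd F) 0 0 0 = 0"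

(* f(u(x,y,eps), v(x,y,eps), eps), for u and v without constant term.  Then u^i v^j eps^p has only
   monomials of total degree at least i + j + p, so the truncation at k + l + m drops only zeros. *)
definition psubst :: "series \<Rightarrow> series \<Rightarrow> series \<Rightarrow> series" where
  "psubst f u v = mk_series (\<lambda>k l m.
     \<Sum>i\<le>k+l+m. \<Sum>j\<le>k+l+m. \<Sum>p\<le>k+l+m. cf f i j p * cf (u ^ i * v ^ j * sE ^ p) k l m)"

definition fcomp :: "fmap \<Rightarrow> fmap \<Rightarrow> fmap"  (infixl "\<circ>\<^sub>f" 55) where
  "F \<circ>\<^sub>f G = (psubst (fst F) (fst G) (snd G), psubst (snd F) (fst G) (snd G))"

definition fid :: fmap where "fid = (sX, sY)"

definition Dmap :: fmap where "Dmap = (- sX, sY)"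

definition is_inverse :: "fmap \<Rightarrow> fmap \<Rightarrow> bool" where
  "is_inverse \<eta> \<phi> \<longleftrightarrow> fixes_origin \<eta> \<and> \<eta> \<circ>\<^sub>f \<phi> = fid \<and> \<phi> \<circ>\<^sub>f \<eta> = fid"

definition conjugates :: "fmap \<Rightarrow> fmap \<Rightarrow> fmap \<Rightarrow> bool" where
  "conjugates \<phi> F G \<longleftrightarrow> (\<exists>\<eta>. is_inverse \<eta> \<phi> \<and> F = \<eta> \<circ>\<^sub>f G \<circ>\<^sub>f \<phi>)"

definition canonical :: "fmap \<Rightarrow> bool" where
  "canonical \<phi> \<longleftrightarrow> fixes_origin \<phi> \<and> jac \<phi> = 1"

definition order_ge3 :: "series \<Rightarrow> bool" where
  "order_ge3 h \<longleftrightarrow> (\<forall>k l m. cf h k l m \<noteq> 0 \<longrightarrow> k + l + 3 * m \<ge> 3)"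

definition odd_in_x :: "series \<Rightarrow> bool" where
  "odd_in_x f \<longleftrightarrow> psubst f (- sX) sY = - f"

definition lie :: "series \<Rightarrow> series \<Rightarrow> series" where
  "lie \<eta> g = poisson g \<eta>"

(* For order_ge3 eta, lie eta raises the order k + l + 3 * m, so each coefficient series below
   has only finitely many non-zero terms. *)
definition exp_lie :: "series \<Rightarrow> series \<Rightarrow> series" where
  "exp_lie \<eta> g = mk_series (\<lambda>k l m. \<Sum>n. cf ((lie \<eta> ^^ n) g) k l m / fact n)"

definition time_one :: "series \<Rightarrow> fmap" where
  "time_one \<eta> = (exp_lie \<eta> sX, exp_lie \<eta> sY)"

definition lin_part :: "fmap \<Rightarrow> real \<times> real \<Rightarrow> real \<times> real" where
  "lin_part F = (\<lambda>(s, t). (cf (fst F) 1 0 0 * s + cf (fst F) 0 1 0 * t,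
                           cf (snd F) 1 0 0 * s + cf (snd F) 0 1 0 * t))"

definition has_eigenvalue :: "(real \<times> real \<Rightarrow> real \<times> real) \<Rightarrow> real \<Rightarrow> bool" where
  "has_eigenvalue L \<mu> \<longleftrightarrow> (\<exists>v. v \<noteq> 0 \<and> L v = \<mu> *\<^sub>R v)"

definition analytic_expansion ::
    "(real \<times> real \<times> real) set \<Rightarrow> (real \<times> real \<times> real \<Rightarrow> real) \<Rightarrow> series \<Rightarrow> bool" where
  "analytic_expansion U f T \<longleftrightarrow>
     (\<forall>(x, y, e) \<in> U. ((\<lambda>(k, l, m). cf T k l m * x ^ k * y ^ l * e ^ m) has_sum f (x, y, e)) UNIV)"

(* P k l m is the partial derivative of f of order k in x, l in y and m in eps; the existence of
   such a P with every P k l m differentiable on the open set U says that f is smooth on U. *)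
definition smooth_expansion ::
    "(real \<times> real \<times> real) set \<Rightarrow> (real \<times> real \<times> real \<Rightarrow> real) \<Rightarrow> series \<Rightarrow> bool" where
  "smooth_expansion U f T \<longleftrightarrow>
     (\<exists>P :: nat \<Rightarrow> nat \<Rightarrow> nat \<Rightarrow> real \<times> real \<times> real \<Rightarrow> real.
        (\<forall>p\<in>U. P 0 0 0 p = f p) \<and>
        (\<forall>k l m. \<forall>p\<in>U. (P k l m has_derivative
           (\<lambda>(a, b, c). a * P (Suc k) l m p + b * P k (Suc l) m p + c * P k l (Suc m) p)) (at p)) \<and>
        (\<forall>k l m. cf T k l m = P k l m (0, 0, 0) / (fact k * fact l * fact m)))"

(* Jacobian determinant of (x,y) |-> (f (x,y,eps), g (x,y,eps)) *)
definition jac_det :: "(real \<times> real \<times> real \<Rightarrow> real) \<Rightarrow> (real \<times> real \<times> real \<Rightarrow> real)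
    \<Rightarrow> real \<times> real \<times> real \<Rightarrow> real" where
  "jac_det f g = (\<lambda>(x, y, e).
      deriv (\<lambda>s. f (s, y, e)) x * deriv (\<lambda>t. g (x, t, e)) y
    - deriv (\<lambda>t. f (x, t, e)) y * deriv (\<lambda>s. g (s, y, e)) x)"

definition formal_family :: "fmap \<Rightarrow> bool" where
  "formal_family F \<longleftrightarrow> jac F = -1"

(* An analytic or smooth family enters through its Taylor series F at the origin. *)
definition analytic_family :: "fmap \<Rightarrow> bool" where
  "analytic_family F \<longleftrightarrow> (\<exists>U f g. open U \<and> (0, 0, 0) \<in> U \<and>
     analytic_expansion U f (fst F) \<and> analytic_expansion U g (snd F) \<and>
     (\<forall>p\<in>U. jac_det f g p = -1))"

definition smooth_family :: "fmap \<Rightarrow> bool" where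
  "smooth_family F \<longleftrightarrow> (\<exists>U f g. open U \<and> (0, 0, 0) \<in> U \<and>
     smooth_expansion U f (fst F) \<and> smooth_expansion U g (snd F) \<and>
     (\<forall>p\<in>U. jac_det f g p = -1))"

(* There are psi and g with F = psi^{-1} o (D o Phi^1_g) o psi, and the cubic part of g at eps = 0
   is b x y^2 + c x^3 with b nonzero. *)
definition nondegenerate :: "fmap \<Rightarrow> bool" where
  "nondegenerate F \<longleftrightarrow> (\<exists>\<psi> g b c. canonical \<psi> \<and> order_ge3 g \<and> odd_in_x g \<and>
     conjugates \<psi> F (Dmap \<circ>\<^sub>f time_one g) \<and>
     (\<forall>k l. k + l = 3 \<longrightarrow> cf g k l 0 = cf (sconst b * sX * sY ^ 2 + sconst c * sX ^ 3) k l 0) \<and>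
     b \<noteq> 0)"

definition A_form :: "series \<Rightarrow> bool" where
  "A_form A \<longleftrightarrow> (\<forall>i j m. cf A i j m \<noteq> 0 \<longrightarrow>
     j = 0 \<and> (\<exists>k\<ge>1. i = 2 * k - 1 \<and> (2 * k - 1) + 3 * m \<ge> 4))"

(* B stands for the series B(x y^2, eps) in x, y and eps *)
definition B_form :: "series \<Rightarrow> bool" where
  "B_form B \<longleftrightarrow> (\<forall>i j m. cf B i j m \<noteq> 0 \<longrightarrow>
     (\<exists>k\<ge>1. i = 2 * k - 1 \<and> j = 2 * (2 * k - 1)))"

definition normal_ham :: "real \<Rightarrow> series \<Rightarrow> series \<Rightarrow> series" where
  "normal_ham a A B = sX * sY ^ 2 + sconst a * sX ^ 3 + A + sY * B"

definition brings_to_normal_form :: "fmap \<Rightarrow> fmap \<Rightarrow> real \<Rightarrow> series \<Rightarrow> series \<Rightarrow> bool" where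
  "brings_to_normal_form \<phi> F a A B \<longleftrightarrow> canonical \<phi> \<and> A_form A \<and> B_form B \<and>
     conjugates \<phi> F (Dmap \<circ>\<^sub>f time_one (normal_ham a A B))"

end

theory Submission
  imports Defs
begin

text \<open>
  A map acts on series by substitution; this is a ring endomorphism which is continuous for the
  filtration by the weight \<open>k + l + 3 m\<close> of \<open>x\<^sup>k y\<^sup>l \<epsilon>\<^sup>m\<close>, and canonical maps act by Poisson
  endomorphisms.  With \<open>h\<^sub>3 = x y\<^sup>2 + a x\<^sup>3\<close>,
  \<open>{x\<^sup>i y\<^sup>j, h\<^sub>3} = (2 i - j) x\<^sup>i y\<^sup>j\<^sup>+\<^sup>1 - 3 j a x\<^sup>i\<^sup>+\<^sup>2 y\<^sup>j\<^sup>-\<^sup>1\<close>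
  is triangular with respect to \<open>i\<close>, so for odd series a complement of the image of \<open>{\<cdot>, h\<^sub>3}\<close>
  is spanned by the monomials \<open>\<epsilon>\<^sup>m x\<^sup>i\<close> and \<open>\<epsilon>\<^sup>m x\<^sup>i y\<^sup>2\<^sup>i\<^sup>+\<^sup>1\<close> with \<open>i\<close> odd.
  Existence: after a diagonal scaling, solve \<open>exp(L\<^sub>\<chi>) h = g\<close> for \<open>\<chi>\<close> and \<open>h\<close> weight by weight;
  since \<open>\<chi>\<close> is odd in \<open>x\<close>, its time-one map commutes with \<open>D\<close>.

  Uniqueness: if \<open>\<phi>\<close> conjugates \<open>D \<circ> \<Phi>\<^sub>h\<close> to \<open>D \<circ> \<Phi>\<^sub>h\<^sub>'\<close>, then it conjugates their squares
  \<open>\<Phi>\<^sub>h \<circ> \<Phi>\<^sub>h\<close> and \<open>\<Phi>\<^sub>h\<^sub>' \<circ> \<Phi>\<^sub>h\<^sub>'\<close>, whence \<open>h' \<circ> \<phi> - h\<close> depends on \<open>\<epsilon>\<close> only; so \<open>\<phi>\<close> commutes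
  with \<open>D\<close>, and then \<open>h' \<circ> \<phi> = h\<close> by oddness.  The leading Hamiltonian of \<open>\<phi>\<close> must lie in
  the kernel of \<open>{\<cdot>, h\<^sub>3}\<close>, which is spanned by \<open>\<epsilon>\<^sup>m h\<^sub>3\<^sup>i\<close>.  Replacing \<open>h\<^sub>3\<close> by \<open>h\<close> there gives a flow
  that preserves \<open>h\<close> exactly; composing \<open>\<phi>\<close> with its inverse moves \<open>\<phi>\<close> one weight closer to the
  identity, and \<open>h\<close> and \<open>h'\<close> agree one weight further.
\<close>

unbundle no vec_syntax
unbundle fps_syntax

section \<open>Coefficients and derivations\<close>

lemma series_eqI: "(\<And>k l m. cf f k l m = cf g k l m) \<Longrightarrow> f = g"
  by (simp add: cf_def fps_eq_iff)

lemma cf_mk_series [simp]: "cf (mk_series c) k l m = c k l m"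
  by (simp add: cf_def mk_series_def)

lemma cf_0 [simp]: "cf 0 k l m = 0"
  and cf_add [simp]: "cf (f + g) k l m = cf f k l m + cf g k l m"
  and cf_diff [simp]: "cf (f - g) k l m = cf f k l m - cf g k l m"
  and cf_uminus [simp]: "cf (- f) k l m = - cf f k l m"
  and cf_sconst_mult [simp]: "cf (sconst r * f) k l m = r * cf f k l m"
  by (simp_all add: cf_def sconst_def)

lemma cf_sum [simp]: "cf (sum f A) k l m = (\<Sum>i\<in>A. cf (f i) k l m)"
  by (simp add: cf_def fps_sum_nth)

lemma cf_1: "cf 1 k l m = (if k = 0 \<and> l = 0 \<and> m = 0 then 1 else 0)"
  by (auto simp: cf_def)

lemma cf_sX_mult: "cf (sX * f) k l m = (case k of 0 \<Rightarrow> 0 | Suc k' \<Rightarrow> cf f k' l m)"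
  and cf_sY_mult: "cf (sY * f) k l m = (case l of 0 \<Rightarrow> 0 | Suc l' \<Rightarrow> cf f k l' m)"
  and cf_sE_mult: "cf (sE * f) k l m = (case m of 0 \<Rightarrow> 0 | Suc m' \<Rightarrow> cf f k l m')"
  by (simp_all add: cf_def sX_def sY_def sE_def split: nat.split)

lemma cf_mult:
  "cf (f * g) k l m =
     (\<Sum>p=0..m. \<Sum>j=0..l. \<Sum>i=0..k. cf f i j p * cf g (k - i) (l - j) (m - p))"
  by (simp add: cf_def fps_mult_nth fps_sum_nth)

lemma sconst_simps [simp]:
  "sconst 0 = 0" "sconst 1 = 1" "sconst (- r) = - sconst r"
  "sconst (r + s) = sconst r + sconst s" "sconst (r * s) = sconst r * sconst s"
  by (simp_all add: sconst_def fps_const_add[symmetric] fps_const_mult[symmetric]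
      fps_const_neg[symmetric] del: fps_const_add fps_const_mult fps_const_neg)

lemma cf_pd_x [simp]: "cf (pd_x f) k l m = real (Suc k) * cf f (Suc k) l m"
  by (simp add: cf_def pd_x_def)

lemma cf_pd_y [simp]: "cf (pd_y f) k l m = real (Suc l) * cf f k (Suc l) m"
proof -
  have "(of_nat (Suc l) :: real fps) = fps_const (real (Suc l))"
    by (rule fps_of_nat[symmetric])
  then show ?thesis
    by (simp add: cf_def pd_y_def del: of_nat_Suc)
qed

lemma pd_x_linear [simp]:
  "pd_x 0 = 0" "pd_x (f + g) = pd_x f + pd_x g" "pd_x (f - g) = pd_x f - pd_x g"
  "pd_x (- f) = - pd_x f" "pd_x (sconst r) = 0"
  by (rule series_eqI, simp add: algebra_simps cf_def sconst_def pd_x_def)+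

lemma pd_y_linear [simp]:
  "pd_y 0 = 0" "pd_y (f + g) = pd_y f + pd_y g" "pd_y (f - g) = pd_y f - pd_y g"
  "pd_y (- f) = - pd_y f" "pd_y (sconst r) = 0"
  by (rule series_eqI, simp add: algebra_simps cf_def sconst_def pd_y_def)+

lemma pd_x_mult: "pd_x (f * g) = pd_x f * g + f * pd_x g"
proof (rule fps_ext, rule fps_ext)
  fix m l
  have "fps_deriv (\<Sum>p=0..m. \<Sum>j=0..l. f $ p $ j * g $ (m - p) $ (l - j)) =
     (\<Sum>p=0..m. \<Sum>j=0..l. fps_deriv (f $ p $ j) * g $ (m - p) $ (l - j)) +
     (\<Sum>p=0..m. \<Sum>j=0..l. f $ p $ j * fps_deriv (g $ (m - p) $ (l - j)))"
    by (simp add: fps_deriv_sum sum.distrib[symmetric] algebra_simps)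
  then show "pd_x (f * g) $ m $ l = (pd_x f * g + f * pd_x g) $ m $ l"
    by (simp add: pd_x_def fps_mult_nth fps_sum_nth)
qed

lemma pd_y_mult: "pd_y (f * g) = pd_y f * g + f * pd_y g"
proof (rule fps_ext)
  fix m
  show "pd_y (f * g) $ m = (pd_y f * g + f * pd_y g) $ m"
    by (simp add: pd_y_def fps_mult_nth fps_deriv_sum sum.distrib[symmetric] add.commute)
qed

lemma pd_1 [simp]: "pd_x 1 = 0" "pd_y 1 = 0"
  using pd_x_linear(5)[of 1] pd_y_linear(5)[of 1] by simp_all

lemma cf_gen: "cf sX k l m = (if k = 1 \<and> l = 0 \<and> m = 0 then 1 else 0)"
  "cf sY k l m = (if k = 0 \<and> l = 1 \<and> m = 0 then 1 else 0)"
  "cf sE k l m = (if k = 0 \<and> l = 0 \<and> m = 1 then 1 else 0)"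
  using cf_sX_mult[of 1 k l m] cf_sY_mult[of 1 k l m] cf_sE_mult[of 1 k l m]
  by (auto simp: cf_1 split: nat.splits)

lemma pd_gen [simp]: "pd_x sX = 1" "pd_x sY = 0" "pd_x sE = 0"
  "pd_y sX = 0" "pd_y sY = 1" "pd_y sE = 0"
  by (rule series_eqI, simp add: cf_gen cf_1)+

lemma pd_commute: "pd_x (pd_y f) = pd_y (pd_x f)"
  by (rule series_eqI) (simp add: algebra_simps)

lemma pd_sconst_mult [simp]: "pd_x (sconst r * f) = sconst r * pd_x f"
  "pd_y (sconst r * f) = sconst r * pd_y f"
  by (simp_all add: pd_x_mult pd_y_mult)

section \<open>Weight filtrations\<close>

text \<open>
  Besides \<open>q = 3\<close>, only \<open>q = 1\<close> is needed: it matches the truncation in \<open>psubst\<close> at total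
  degree \<open>k + l + m\<close>.
\<close>

definition wt :: "nat \<Rightarrow> nat \<Rightarrow> series set" where
  "wt q n = {f. \<forall>k l m. k + l + q * m < n \<longrightarrow> cf f k l m = 0}"

abbreviation W :: "nat \<Rightarrow> series set" where "W \<equiv> wt 3"

lemma wtI: "(\<And>k l m. k + l + q * m < n \<Longrightarrow> cf f k l m = 0) \<Longrightarrow> f \<in> wt q n"
  by (simp add: wt_def)

lemma wtD: "f \<in> wt q n \<Longrightarrow> k + l + q * m < n \<Longrightarrow> cf f k l m = 0"
  by (simp add: wt_def)

lemma wt_0 [simp, intro]: "0 \<in> wt q n"
  by (simp add: wt_def)

lemma wt_zero [simp, intro]: "f \<in> wt q 0"
  by (simp add: wt_def)

lemma wt_add [intro]: "f \<in> wt q n \<Longrightarrow> g \<in> wt q n \<Longrightarrow> f + g \<in> wt q n"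
  and wt_diff [intro]: "f \<in> wt q n \<Longrightarrow> g \<in> wt q n \<Longrightarrow> f - g \<in> wt q n"
  and wt_uminus [intro]: "f \<in> wt q n \<Longrightarrow> - f \<in> wt q n"
  and wt_sconst [intro]: "f \<in> wt q n \<Longrightarrow> sconst r * f \<in> wt q n"
  by (simp_all add: wt_def)

lemma wt_sum [intro]: "(\<And>i. i \<in> A \<Longrightarrow> f i \<in> wt q n) \<Longrightarrow> sum f A \<in> wt q n"
  by (simp add: wt_def)

lemma wt_mono: "f \<in> wt q n \<Longrightarrow> m \<le> n \<Longrightarrow> f \<in> wt q m"
  by (auto simp: wt_def)

lemma wt_mult: "f \<in> wt q i \<Longrightarrow> g \<in> wt q j \<Longrightarrow> f * g \<in> wt q (i + j)"
proof (rule wtI)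
  fix k l m
  assume f: "f \<in> wt q i" and g: "g \<in> wt q j" and klm: "k + l + q * m < i + j"
  have "cf f a b c * cf g (k - a) (l - b) (m - c) = 0" if "a \<le> k" "b \<le> l" "c \<le> m" for a b c
  proof (cases "a + b + q * c < i")
    case True
    then show ?thesis using wtD[OF f] by simp
  next
    case False
    have "q * c + q * (m - c) = q * m"
      using that by (simp add: distrib_left[symmetric])
    then have "(k - a) + (l - b) + q * (m - c) < j"
      using False klm that by linarith
    then show ?thesis using wtD[OF g] by simp
  qed
  then show "cf (f * g) k l m = 0"
    unfolding cf_mult by (intro sum.neutral ballI) simp
qed

lemma wt_mult_le: "f \<in> wt q i \<Longrightarrow> g \<in> wt q j \<Longrightarrow> n \<le> i + j \<Longrightarrow> f * g \<in> wt q n"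
  by (rule wt_mono[OF wt_mult])

lemma wt_mult_left: "f \<in> wt q n \<Longrightarrow> g * f \<in> wt q n"
  using wt_mult_le[of g q 0 f n n] by simp

lemma wt_power: "f \<in> wt q i \<Longrightarrow> f ^ n \<in> wt q (n * i)"
proof (induction n)
  case (Suc n)
  then show ?case using wt_mult[of f q i "f ^ n" "n * i"] by simp
qed simp

text \<open>Separatedness of the filtration: identities between limits are proved below by showing
  that the difference of the two sides has weight at least \<open>n\<close> for every
  \<open>n\<close>.\<close>

lemma wt_eq_0: "(\<And>n. f \<in> wt q n) \<Longrightarrow> f = 0"
proof (rule series_eqI)
  fix k l m assume "\<And>n. f \<in> wt q n"
  then show "cf f k l m = cf 0 k l m"
    using wtD[of f q "Suc (k + l + q * m)" k l m] by simp
qed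

lemma wt_1_iff: "q > 0 \<Longrightarrow> f \<in> wt q 1 \<longleftrightarrow> cf f 0 0 0 = 0"
  by (auto simp: wt_def)

lemma wt_gen: "sX \<in> wt q 1" "sY \<in> wt q 1" "sE \<in> wt q q"
  by (auto simp: wt_def cf_gen)

lemma wt_pd: "f \<in> wt q n \<Longrightarrow> pd_x f \<in> wt q (n - 1)" "f \<in> wt q n \<Longrightarrow> pd_y f \<in> wt q (n - 1)"
  by (auto simp: wt_def)

lemma poisson_wt: "f \<in> wt q i \<Longrightarrow> g \<in> wt q j \<Longrightarrow> n + 2 \<le> i + j \<Longrightarrow> poisson f g \<in> wt q n"
proof -
  assume a: "f \<in> wt q i" "g \<in> wt q j" "n + 2 \<le> i + j"
  have 1: "n \<le> (i - 1) + (j - 1)" using a(3) by linarith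
  show ?thesis unfolding poisson_def
    by (intro wt_diff wt_mult_le[OF _ _ 1] wt_pd a)
qed

section \<open>Monomials and truncation\<close>

definition mon :: "nat \<Rightarrow> nat \<Rightarrow> nat \<Rightarrow> series" where
  "mon i j p = sX ^ i * sY ^ j * sE ^ p"

lemma cf_sX_power_mult: "cf (sX ^ i * f) k l m = (if i \<le> k then cf f (k - i) l m else 0)"
  by (induction i arbitrary: k)
    (auto simp: mult.assoc cf_sX_mult split: nat.split)

lemma cf_sY_power_mult: "cf (sY ^ i * f) k l m = (if i \<le> l then cf f k (l - i) m else 0)"
  by (induction i arbitrary: l)
    (auto simp: mult.assoc cf_sY_mult split: nat.split)

lemma cf_sE_power_mult: "cf (sE ^ i * f) k l m = (if i \<le> m then cf f k l (m - i) else 0)"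
  by (induction i arbitrary: m)
    (auto simp: mult.assoc cf_sE_mult split: nat.split)

lemma cf_mon: "cf (mon i j p) k l m = (if k = i \<and> l = j \<and> m = p then 1 else 0)"
  using cf_sE_power_mult[of p 1]
  by (auto simp: mon_def mult.assoc cf_sX_power_mult cf_sY_power_mult cf_1)

lemma mon_mult: "mon i j p * mon i' j' p' = mon (i + i') (j + j') (p + p')"
  by (simp add: mon_def power_add algebra_simps)

text \<open>The cut is by a box in the exponents, so the truncation is a finite sum of monomials; by
  \<open>trunc_wt\<close> the remainder has weight at least \<open>Suc N\<close> for every
  \<open>q > 0\<close>.\<close>

definition trunc :: "nat \<Rightarrow> series \<Rightarrow> series" where
  "trunc N f = (\<Sum>i\<le>N. \<Sum>j\<le>N. \<Sum>p\<le>N. sconst (cf f i j p) * mon i j p)"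

lemma sum3_delta:
  fixes g :: "nat \<Rightarrow> nat \<Rightarrow> nat \<Rightarrow> real"
  shows "(\<Sum>i\<le>N. \<Sum>j\<le>N. \<Sum>p\<le>N. g i j p * (if k = i \<and> l = j \<and> m = p then 1 else 0)) =
    (if k \<le> N \<and> l \<le> N \<and> m \<le> N then g k l m else 0)"
proof -
  have *: "(\<Sum>p\<le>N. g i j p * (if k = i \<and> l = j \<and> m = p then 1 else 0)) =
    (if l = j then if k = i then if m \<le> N then g i j m else 0 else 0 else 0)" for i j
    by (simp add: if_distrib[of "(*) _"] cong: if_cong)
  show ?thesis unfolding *
    by (simp add: if_distrib[of "sum _"] cong: if_cong)
qed

lemma cf_trunc: "cf (trunc N f) k l m = (if k \<le> N \<and> l \<le> N \<and> m \<le> N then cf f k l m else 0)"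
  by (simp add: trunc_def cf_mon sum3_delta)

lemma trunc_wt: "q > 0 \<Longrightarrow> n \<le> Suc N \<Longrightarrow> f - trunc N f \<in> wt q n"
proof (rule wtI)
  fix k l m assume "q > 0" "n \<le> Suc N" "k + l + q * m < n"
  moreover have "m \<le> q * m" using \<open>q > 0\<close> by simp
  ultimately have "k \<le> N" "l \<le> N" "m \<le> N" by linarith+
  then show "cf (f - trunc N f) k l m = 0" by (simp add: cf_trunc)
qed

text \<open>
  Additive maps that lower the weight by a bounded amount: they are determined by their values
  on monomials (\<open>cadd_ext\<close>), which reduces most identities below to monomials.
\<close>

definition cadd :: "(series \<Rightarrow> series) \<Rightarrow> bool" where
  "cadd T \<longleftrightarrow> (\<forall>f g. T (f + g) = T f + T g) \<and> (\<exists>c. \<forall>n. \<forall>f\<in>W (n + c). T f \<in> W n)"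

lemma caddI:
  assumes "\<And>f g. T (f + g) = T f + T g" "\<And>n f. f \<in> W (n + c) \<Longrightarrow> T f \<in> W n"
  shows "cadd T"
  unfolding cadd_def using assms by blast

lemma cadd_add: "cadd T \<Longrightarrow> T (f + g) = T f + T g"
  by (simp add: cadd_def)

lemma cadd_0: "cadd T \<Longrightarrow> T 0 = 0"
  using cadd_add[of T 0 0] by simp

lemma cadd_uminus: "cadd T \<Longrightarrow> T (- f) = - T f"
  using cadd_add[of T f "- f"] cadd_0[of T] by (simp add: eq_neg_iff_add_eq_0 add.commute)

lemma cadd_diff: "cadd T \<Longrightarrow> T (f - g) = T f - T g"
  using cadd_add[of T f "- g"] cadd_uminus[of T g] by simp

lemma cadd_sum: "cadd T \<Longrightarrow> T (sum f A) = (\<Sum>i\<in>A. T (f i))"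
  by (induction A rule: infinite_finite_induct) (auto simp: cadd_0 cadd_add)

lemma cadd_compose:
  assumes "cadd T" "cadd S"
  shows "cadd (\<lambda>f. T (S f))"
proof -
  obtain c d where c: "\<And>n f. f \<in> W (n + c) \<Longrightarrow> T f \<in> W n" and d: "\<And>n f. f \<in> W (n + d) \<Longrightarrow> S f \<in> W n"
    using assms unfolding cadd_def by blast
  show ?thesis
  proof (rule caddI[where c = "c + d"])
    show "T (S (f + g)) = T (S f) + T (S g)" for f g
      using assms by (simp add: cadd_add)
    show "T (S f) \<in> W n" if "f \<in> W (n + (c + d))" for n f
      using that by (auto intro!: c d simp: add.assoc)
  qed
qed

lemma cadd_plus:
  assumes "cadd T" "cadd S"
  shows "cadd (\<lambda>f. T f + S f)"
proof -
  obtain c d where c: "\<And>n f. f \<in> W (n + c) \<Longrightarrow> T f \<in> W n" and d: "\<And>n f. f \<in> W (n + d) \<Longrightarrow> S f \<in> W n"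
    using assms unfolding cadd_def by blast
  show ?thesis
  proof (rule caddI[where c = "c + d"])
    show "T (f + g) + S (f + g) = T f + S f + (T g + S g)" for f g
      using assms by (simp add: cadd_add)
    show "T f + S f \<in> W n" if "f \<in> W (n + (c + d))" for n f
      by (rule wt_add[OF c d]; rule wt_mono[OF that]; simp)
  qed
qed

lemma cadd_id: "cadd (\<lambda>f. f)"
  by (rule caddI[where c = 0]) auto

lemma cadd_mult: "cadd (\<lambda>f. g * f)"
  by (rule caddI[where c = 0]) (auto simp: distrib_left intro: wt_mult_left)

lemma cadd_mult_right: "cadd T \<Longrightarrow> cadd (\<lambda>f. T f * g)"
  using cadd_compose[OF cadd_mult[of g], of T] by (simp add: mult.commute)

lemma cadd_mult_left: "cadd T \<Longrightarrow> cadd (\<lambda>f. g * T f)"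
  using cadd_compose[OF cadd_mult[of g], of T] by simp

lemma cadd_minus: "cadd T \<Longrightarrow> cadd S \<Longrightarrow> cadd (\<lambda>f. T f - S f)"
  using cadd_plus[of T "\<lambda>f. - 1 * S f"] cadd_mult_left[of S "- 1"] by simp

lemma cadd_pd_x: "cadd pd_x" and cadd_pd_y: "cadd pd_y"
  by (rule caddI[where c = 1]; use wt_pd in force)+

text \<open>The difference \<open>U\<close> of the two maps kills truncations, so \<open>U f\<close>
  is the image of a remainder; as \<open>U\<close> lowers weights by a bounded amount, that image
  has arbitrarily high weight.\<close>

lemma cadd_ext:
  assumes T: "cadd T" and S: "cadd S"
    and eq: "\<And>r i j p. T (sconst r * mon i j p) = S (sconst r * mon i j p)"
  shows "T f = S f"
proof -
  define U where "U = (\<lambda>f. T f - S f)"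
  have U: "cadd U" unfolding U_def by (rule cadd_minus[OF T S])
  then obtain c where c: "\<And>n f. f \<in> W (n + c) \<Longrightarrow> U f \<in> W n"
    unfolding cadd_def by blast
  have "U f \<in> W n" for n
  proof -
    have "U (trunc (n + c) f) = 0"
      by (simp add: trunc_def cadd_sum[OF U]) (simp add: U_def eq)
    then have "U f = U (f - trunc (n + c) f)"
      by (simp add: cadd_diff[OF U])
    then show ?thesis using c trunc_wt[of 3 "n + c" "n + c" f] by simp
  qed
  then have "U f = 0" by (rule wt_eq_0)
  then show ?thesis by (simp add: U_def)
qed

section \<open>Substitution endomorphisms\<close>

text \<open>By \<open>psubst_shom\<close> and \<open>shom_psubst\<close> these are exactly the
  substitutions \<open>f(u, v, \<epsilon>)\<close> with \<open>u\<close> and \<open>v\<close>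
  without constant term. The algebraic description is closed under composition and applies directly
  to Lie exponentials.\<close>

definition shom :: "(series \<Rightarrow> series) \<Rightarrow> bool" where
  "shom T \<longleftrightarrow> (\<forall>f g. T (f + g) = T f + T g) \<and> (\<forall>f g. T (f * g) = T f * T g) \<and>
     (\<forall>r. T (sconst r) = sconst r) \<and> T sE = sE \<and> (\<forall>n. \<forall>f\<in>W n. T f \<in> W n)"

lemma shomD:
  assumes "shom T"
  shows "T (f + g) = T f + T g" "T (f * g) = T f * T g" "T (sconst r) = sconst r"
    "T sE = sE" "f \<in> W n \<Longrightarrow> T f \<in> W n"
  using assms by (auto simp: shom_def)

lemma shom_cadd: "shom T \<Longrightarrow> cadd T"
  by (rule caddI[where c = 0]) (auto simp: shomD)

lemma shom_simps:
  assumes "shom T"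
  shows "T 0 = 0" "T 1 = 1" "T (- f) = - T f" "T (f - g) = T f - T g" "T (f ^ n) = T f ^ n"
    "T (sum h A) = (\<Sum>i\<in>A. T (h i))"
proof -
  show "T 0 = 0" "T (- f) = - T f" "T (f - g) = T f - T g" "T (sum h A) = (\<Sum>i\<in>A. T (h i))"
    using shom_cadd[OF assms] by (auto simp: cadd_0 cadd_uminus cadd_diff cadd_sum)
  show 1: "T 1 = 1" using shomD(3)[OF assms, of 1] by simp
  show "T (f ^ n) = T f ^ n"
    by (induction n) (auto simp: 1 shomD[OF assms])
qed

lemma shom_compose: "shom T \<Longrightarrow> shom S \<Longrightarrow> shom (\<lambda>f. T (S f))"
  by (simp add: shom_def)

lemma shom_id: "shom (\<lambda>f. f)"
  by (simp add: shom_def)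

lemma shom_ext:
  assumes "shom T" "shom S" "T sX = S sX" "T sY = S sY"
  shows "T f = S f"
proof (rule cadd_ext[of T S])
  show "cadd T" "cadd S" using assms by (auto intro: shom_cadd)
  show "T (sconst r * mon i j p) = S (sconst r * mon i j p)" for r i j p
    by (simp add: mon_def shomD[OF assms(1)] shomD[OF assms(2)] shom_simps[OF assms(1)]
        shom_simps[OF assms(2)] assms(3,4))
qed

definition smon :: "series \<Rightarrow> series \<Rightarrow> nat \<Rightarrow> nat \<Rightarrow> nat \<Rightarrow> series" where
  "smon u v i j p = u ^ i * v ^ j * sE ^ p"

lemma smon_wt:
  assumes "u \<in> wt q 1" "v \<in> wt q 1"
  shows "smon u v i j p \<in> wt q (i + j + q * p)"
  unfolding smon_def
  using wt_power[OF assms(1), of i] wt_power[OF assms(2), of j] wt_power[OF wt_gen(3), of p q]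
  by (intro wt_mult) (simp_all add: mult.commute)

lemma sum3_shrink:
  fixes g :: "nat \<Rightarrow> nat \<Rightarrow> nat \<Rightarrow> real"
  assumes "M \<le> N" and 0: "\<And>i j p. i > M \<or> j > M \<or> p > M \<Longrightarrow> g i j p = 0"
  shows "(\<Sum>i\<le>M. \<Sum>j\<le>M. \<Sum>p\<le>M. g i j p) = (\<Sum>i\<le>N. \<Sum>j\<le>N. \<Sum>p\<le>N. g i j p)"
proof -
  have sub: "{..M} \<subseteq> {..N}" using assms by simp
  have "(\<Sum>i\<le>M. \<Sum>j\<le>M. \<Sum>p\<le>M. g i j p) = (\<Sum>i\<le>M. \<Sum>j\<le>M. \<Sum>p\<le>N. g i j p)"
    by (intro sum.cong[OF refl] sum.mono_neutral_left sub) (auto simp: 0)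
  also have "\<dots> = (\<Sum>i\<le>M. \<Sum>j\<le>N. \<Sum>p\<le>N. g i j p)"
    by (intro sum.cong[OF refl] sum.mono_neutral_left sub) (auto simp: 0)
  also have "\<dots> = (\<Sum>i\<le>N. \<Sum>j\<le>N. \<Sum>p\<le>N. g i j p)"
    by (rule sum.mono_neutral_left[OF _ sub]) (auto simp: 0)
  finally show ?thesis .
qed

context
  fixes u v :: series
  assumes u0: "cf u 0 0 0 = 0" and v0: "cf v 0 0 0 = 0"
begin

lemma uv_wt: "q > 0 \<Longrightarrow> u \<in> wt q 1" "q > 0 \<Longrightarrow> v \<in> wt q 1"
  using u0 v0 by (simp_all only: wt_1_iff)

text \<open>Summands beyond the cut-off of \<open>psubst\<close> vanish, since
  \<open>smon u v i j p\<close> has total degree at least \<open>i + j + p\<close>; the cut-off can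
  thus be raised to any larger \<open>N\<close>.\<close>

lemma cf_psubst:
  assumes "k + l + m \<le> N"
  shows "cf (psubst f u v) k l m =
    (\<Sum>i\<le>N. \<Sum>j\<le>N. \<Sum>p\<le>N. cf f i j p * cf (smon u v i j p) k l m)"
proof -
  have "cf (smon u v i j p) k l m = 0" if "i > k + l + m \<or> j > k + l + m \<or> p > k + l + m" for i j p
    using smon_wt[OF uv_wt(1)[of 1] uv_wt(2)[of 1], of i j p] that by (auto intro: wtD)
  then show ?thesis
    using sum3_shrink[OF assms, of "\<lambda>i j p. cf f i j p * cf (smon u v i j p) k l m"]
    by (simp add: psubst_def smon_def)
qed

lemma psubst_add: "psubst (f + g) u v = psubst f u v + psubst g u v"
  by (rule series_eqI) (simp add: psubst_def distrib_right sum.distrib)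

lemma psubst_wt:
  assumes "f \<in> W n"
  shows "psubst f u v \<in> W n"
proof (rule wtI)
  fix k l m :: nat assume klm: "k + l + 3 * m < n"
  have "cf f i j p * cf (smon u v i j p) k l m = 0" for i j p
  proof (cases "i + j + 3 * p < n")
    case True
    then show ?thesis using wtD[OF assms] by simp
  next
    case False
    then show ?thesis
      using wtD[OF smon_wt[OF uv_wt(1)[of 3] uv_wt(2)[of 3]], of k l m i j p] klm by simp
  qed
  then show "cf (psubst f u v) k l m = 0"
    unfolding cf_psubst[OF order_refl] by (intro sum.neutral ballI)
qed

lemma psubst_cadd: "cadd (\<lambda>f. psubst f u v)"
  by (rule caddI[where c = 0]) (auto simp: psubst_add psubst_wt)

lemma psubst_mon: "psubst (sconst r * mon i j p) u v = sconst r * smon u v i j p"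
proof (rule series_eqI)
  fix k l m
  define N where "N = k + l + m + i + j + p"
  have "cf (psubst (sconst r * mon i j p) u v) k l m =
    (\<Sum>i'\<le>N. \<Sum>j'\<le>N. \<Sum>p'\<le>N. r * cf (smon u v i' j' p') k l m *
      (if i = i' \<and> j = j' \<and> p = p' then 1 else 0))"
    unfolding cf_psubst[of k l m N, unfolded N_def, simplified] cf_sconst_mult cf_mon N_def
    by (intro sum.cong refl) auto
  also have "\<dots> = r * cf (smon u v i j p) k l m"
    unfolding sum3_delta by (simp add: N_def)
  finally show "cf (psubst (sconst r * mon i j p) u v) k l m = cf (sconst r * smon u v i j p) k l m"
    by simp
qed

lemma smon_mult: "smon u v i j p * smon u v i' j' p' = smon u v (i + i') (j + j') (p + p')"
  by (simp add: smon_def power_add algebra_simps)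

text \<open>Both sides are additive and continuous in each factor, so \<open>cadd_ext\<close>,
  applied first in \<open>f\<close> and then in \<open>g\<close>, leaves products of two
  monomials.\<close>

lemma psubst_mult: "psubst (f * g) u v = psubst f u v * psubst g u v"
proof (rule cadd_ext[of "\<lambda>f. psubst (f * g) u v"])
  show "cadd (\<lambda>f. psubst (f * g) u v)" "cadd (\<lambda>f. psubst f u v * psubst g u v)"
    by (intro cadd_compose[OF psubst_cadd] cadd_mult_right cadd_id psubst_cadd)+
  fix r i j p
  show "psubst (sconst r * mon i j p * g) u v = psubst (sconst r * mon i j p) u v * psubst g u v"
  proof (rule cadd_ext[of "\<lambda>g. psubst (sconst r * mon i j p * g) u v"])
    show "cadd (\<lambda>g. psubst (sconst r * mon i j p * g) u v)"
      "cadd (\<lambda>g. psubst (sconst r * mon i j p) u v * psubst g u v)"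
      by (intro cadd_compose[OF psubst_cadd] cadd_mult_left cadd_id psubst_cadd)+
    fix r' i' j' p'
    have "sconst r * mon i j p * (sconst r' * mon i' j' p') =
      sconst (r * r') * mon (i + i') (j + j') (p + p')"
      by (simp add: mon_mult[symmetric] algebra_simps)
    moreover have "sconst r * smon u v i j p * (sconst r' * smon u v i' j' p') =
      sconst (r * r') * smon u v (i + i') (j + j') (p + p')"
      by (simp add: smon_mult[symmetric] algebra_simps)
    ultimately show "psubst (sconst r * mon i j p * (sconst r' * mon i' j' p')) u v =
        psubst (sconst r * mon i j p) u v * psubst (sconst r' * mon i' j' p') u v"
      by (simp only: psubst_mon)
  qed
qed

lemma psubst_gen: "psubst sX u v = u" "psubst sY u v = v" "psubst sE u v = sE"
  "psubst (sconst r) u v = sconst r"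
  using psubst_mon[of 1 1 0 0] psubst_mon[of 1 0 1 0] psubst_mon[of 1 0 0 1] psubst_mon[of r 0 0 0]
  by (simp_all add: mon_def smon_def)

lemma psubst_shom: "shom (\<lambda>f. psubst f u v)"
  by (simp add: shom_def psubst_add psubst_mult psubst_gen psubst_wt)

text \<open>Both sides are additive and continuous in \<open>f\<close>; on monomials the claim is
  the power rule \<open>pw\<close>.\<close>

lemma chain_x: "pd_x (psubst f u v) = psubst (pd_x f) u v * pd_x u + psubst (pd_y f) u v * pd_x v"
  and chain_y: "pd_y (psubst f u v) = psubst (pd_x f) u v * pd_y u + psubst (pd_y f) u v * pd_y v"
proof -
  note T = psubst_shom
  note S = shomD[OF T] shom_simps[OF T] psubst_gen
  have pw: "pd_x (w ^ n) = of_nat n * w ^ (n - 1) * pd_x w"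
    "pd_y (w ^ n) = of_nat n * w ^ (n - 1) * pd_y w" for w n
  proof (induction n)
    case (Suc n)
    { case 1 show ?case using Suc(1) by (cases n) (simp_all add: pd_x_mult algebra_simps) }
    { case 2 show ?case using Suc(2) by (cases n) (simp_all add: pd_y_mult algebra_simps) }
  qed simp_all
  have of_nat: "psubst (of_nat n) u v = of_nat n" for n
    by (induction n) (simp_all add: S)
  have sE0: "pd_x (sE ^ n) = 0" "pd_y (sE ^ n) = 0" for n
    by (simp_all add: pw)
  show "pd_x (psubst f u v) = psubst (pd_x f) u v * pd_x u + psubst (pd_y f) u v * pd_x v"
  proof (rule cadd_ext[of "\<lambda>f. pd_x (psubst f u v)"])
    show "cadd (\<lambda>f. pd_x (psubst f u v))"
      "cadd (\<lambda>f. psubst (pd_x f) u v * pd_x u + psubst (pd_y f) u v * pd_x v)"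
      by (intro cadd_compose[OF cadd_pd_x] cadd_plus cadd_mult_right psubst_cadd
        cadd_compose[OF psubst_cadd] cadd_pd_x cadd_pd_y)+
    show "pd_x (psubst (sconst r * mon i j p) u v) =
      psubst (pd_x (sconst r * mon i j p)) u v * pd_x u +
      psubst (pd_y (sconst r * mon i j p)) u v * pd_x v" for r i j p
      unfolding psubst_mon unfolding mon_def smon_def
      by (simp add: pd_x_mult pd_y_mult pw S of_nat sE0 algebra_simps)
  qed
  show "pd_y (psubst f u v) = psubst (pd_x f) u v * pd_y u + psubst (pd_y f) u v * pd_y v"
  proof (rule cadd_ext[of "\<lambda>f. pd_y (psubst f u v)"])
    show "cadd (\<lambda>f. pd_y (psubst f u v))"
      "cadd (\<lambda>f. psubst (pd_x f) u v * pd_y u + psubst (pd_y f) u v * pd_y v)"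
      by (intro cadd_compose[OF cadd_pd_y] cadd_plus cadd_mult_right psubst_cadd
        cadd_compose[OF psubst_cadd] cadd_pd_x cadd_pd_y)+
    show "pd_y (psubst (sconst r * mon i j p) u v) =
      psubst (pd_x (sconst r * mon i j p)) u v * pd_y u +
      psubst (pd_y (sconst r * mon i j p)) u v * pd_y v" for r i j p
      unfolding psubst_mon unfolding mon_def smon_def
      by (simp add: pd_x_mult pd_y_mult pw S of_nat sE0 algebra_simps)
  qed
qed

text \<open>By the chain rule the left side is the determinant of a product of two 2 by 2 matrices.
  Substitutions of Jacobian 1 are thus Poisson endomorphisms, and \<open>D\<close>, of Jacobian -1,
  reverses the sign of the bracket.\<close>

lemma psubst_poisson:
  "poisson (psubst f u v) (psubst g u v) = psubst (poisson f g) u v * jac (u, v)"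
  unfolding poisson_def chain_x chain_y jac_def
  by (simp add: shomD[OF psubst_shom] shom_simps[OF psubst_shom] algebra_simps)

end

lemma jac_poisson: "jac F = poisson (fst F) (snd F)"
  by (simp add: jac_def poisson_def)

lemma W1_iff: "f \<in> W 1 \<longleftrightarrow> cf f 0 0 0 = 0"
  by (simp only: wt_1_iff)

lemma shom_gen_wt: "shom T \<Longrightarrow> T sX \<in> W 1" "shom T \<Longrightarrow> T sY \<in> W 1"
  using shomD(5) wt_gen by blast+

lemma shom_psubst:
  assumes "shom T"
  shows "T f = psubst f (T sX) (T sY)"
proof -
  have 0: "cf (T sX) 0 0 0 = 0" "cf (T sY) 0 0 0 = 0"
    using shom_gen_wt[OF assms] by (simp_all only: W1_iff)
  show ?thesis
    by (rule shom_ext[OF assms psubst_shom[OF 0]]) (simp_all add: psubst_gen[OF 0])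
qed

lemma shom_poisson:
  assumes "shom T" "poisson (T sX) (T sY) = 1"
  shows "poisson (T f) (T g) = T (poisson f g)"
proof -
  have 0: "cf (T sX) 0 0 0 = 0" "cf (T sY) 0 0 0 = 0"
    using shom_gen_wt[OF assms(1)] by (simp_all only: W1_iff)
  show ?thesis
    using psubst_poisson[OF 0, of f g] assms(2) by (simp add: shom_psubst[OF assms(1), symmetric] jac_poisson)
qed

section \<open>The contravariant action of maps on series\<close>

definition pull :: "fmap \<Rightarrow> series \<Rightarrow> series" where
  "pull F f = psubst f (fst F) (snd F)"

lemma pull_shom: "fixes_origin F \<Longrightarrow> shom (pull F)"
  and pull_gen: "fixes_origin F \<Longrightarrow> pull F sX = fst F" "fixes_origin F \<Longrightarrow> pull F sY = snd F"
proof -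
  assume "fixes_origin F"
  then have 0: "cf (fst F) 0 0 0 = 0" "cf (snd F) 0 0 0 = 0" by (simp_all add: fixes_origin_def)
  show "shom (pull F)" "pull F sX = fst F" "pull F sY = snd F"
    using psubst_shom[OF 0] psubst_gen[OF 0] by (simp_all add: pull_def[abs_def])
qed

lemma pull_fcomp:
  assumes "fixes_origin F" "fixes_origin G"
  shows "fixes_origin (F \<circ>\<^sub>f G)" "pull (F \<circ>\<^sub>f G) f = pull G (pull F f)"
proof -
  have FG: "F \<circ>\<^sub>f G = (pull G (fst F), pull G (snd F))"
    by (simp add: fcomp_def pull_def)
  have "fst F \<in> W 1" "snd F \<in> W 1"
    using assms by (simp_all only: fixes_origin_def W1_iff)
  then have "pull G (fst F) \<in> W 1" "pull G (snd F) \<in> W 1"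
    using pull_shom[OF assms(2)] shomD(5) by blast+
  then show 0: "fixes_origin (F \<circ>\<^sub>f G)"
    by (simp only: fixes_origin_def FG W1_iff fst_conv snd_conv)
  show "pull (F \<circ>\<^sub>f G) f = pull G (pull F f)"
    by (rule shom_ext[OF pull_shom[OF 0] shom_compose[OF pull_shom pull_shom]])
      (simp_all add: assms pull_gen 0, simp_all add: FG)
qed

lemma pull_inject:
  assumes "fixes_origin F" "fixes_origin G" "\<And>f. pull F f = pull G f"
  shows "F = G"
  using pull_gen[OF assms(1)] pull_gen[OF assms(2)] assms(3) by (simp add: prod_eq_iff)

lemma fid: "fixes_origin fid" "pull fid f = f"
proof -
  show 0: "fixes_origin fid" by (simp add: fixes_origin_def fid_def cf_gen)
  show "pull fid f = f"
    by (rule shom_ext[OF pull_shom[OF 0] shom_id]) (simp_all add: pull_gen 0, simp_all add: fid_def)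
qed

lemma canonical_poisson: "canonical \<phi> \<Longrightarrow> poisson (pull \<phi> f) (pull \<phi> g) = pull \<phi> (poisson f g)"
  by (intro shom_poisson pull_shom) (simp_all add: canonical_def pull_gen jac_poisson)

lemma canonicalI:
  "fixes_origin \<phi> \<Longrightarrow> poisson (pull \<phi> sX) (pull \<phi> sY) = 1 \<Longrightarrow> canonical \<phi>"
  by (simp add: canonical_def pull_gen jac_poisson)

section \<open>Lie series\<close>

lemma poisson_simps:
  "poisson (f + f') g = poisson f g + poisson f' g"
  "poisson f (g + g') = poisson f g + poisson f g'"
  "poisson (f - f') g = poisson f g - poisson f' g"
  "poisson f (g - g') = poisson f g - poisson f g'"
  "poisson (- f) g = - poisson f g"
  "poisson f (- g) = - poisson f g"
  "poisson (sconst r * f) g = sconst r * poisson f g"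
  "poisson f (sconst r * g) = sconst r * poisson f g"
  "poisson 0 g = 0" "poisson f 0 = 0"
  by (simp_all add: poisson_def distrib_left distrib_right left_diff_distrib right_diff_distrib
      mult.left_commute mult.assoc)

lemma poisson_sum_left: "poisson (sum f A) g = (\<Sum>i\<in>A. poisson (f i) g)"
  by (induction A rule: infinite_finite_induct) (auto simp: poisson_simps)

lemma poisson_sum_right: "poisson g (sum f A) = (\<Sum>i\<in>A. poisson g (f i))"
  by (induction A rule: infinite_finite_induct) (auto simp: poisson_simps)

lemma poisson_mult_left: "poisson (f * g) h = poisson f h * g + f * poisson g h"
  and poisson_mult_right: "poisson h (f * g) = poisson h f * g + f * poisson h g"
  by (simp_all add: poisson_def pd_x_mult pd_y_mult algebra_simps)

lemma poisson_antisym: "poisson g f = - poisson f g"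
  by (simp add: poisson_def algebra_simps)

lemma poisson_jacobi: "poisson (poisson f g) h = poisson (poisson f h) g + poisson f (poisson g h)"
  by (simp add: poisson_def pd_x_mult pd_y_mult pd_commute algebra_simps)

lemma order_ge3_iff: "order_ge3 h \<longleftrightarrow> h \<in> W 3"
  by (auto simp: order_ge3_def wt_def not_less[symmetric])

lemma lie_simps [simp]:
  "lie \<eta> 0 = 0" "lie \<eta> (f + g) = lie \<eta> f + lie \<eta> g" "lie \<eta> (sconst r * f) = sconst r * lie \<eta> f"
  "lie \<eta> (- f) = - lie \<eta> f" "lie \<eta> (f - g) = lie \<eta> f - lie \<eta> g"
  "lie \<eta> (sum h A) = (\<Sum>i\<in>A. lie \<eta> (h i))"
  by (simp_all add: lie_def poisson_simps poisson_sum_left)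

lemma lie_wt: "\<eta> \<in> W (Suc (Suc n)) \<Longrightarrow> f \<in> W w \<Longrightarrow> lie \<eta> f \<in> W (w + n)"
  unfolding lie_def by (rule poisson_wt) auto

lemma lie_wt_Suc: "\<eta> \<in> W 3 \<Longrightarrow> f \<in> W w \<Longrightarrow> lie \<eta> f \<in> W (Suc w)"
  using lie_wt[of \<eta> 1 f w] by (simp add: eval_nat_numeral)

definition lterm :: "series \<Rightarrow> nat \<Rightarrow> series \<Rightarrow> series" where
  "lterm \<eta> n f = sconst (1 / fact n) * (lie \<eta> ^^ n) f"

lemma lie_pow_simps:
  "(lie \<eta> ^^ n) (f + g) = (lie \<eta> ^^ n) f + (lie \<eta> ^^ n) g"
  "(lie \<eta> ^^ n) (sconst r * f) = sconst r * (lie \<eta> ^^ n) f"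
  "(lie \<eta> ^^ n) 0 = 0"
  by (induction n) auto

lemma lterm_0 [simp]: "lterm \<eta> 0 f = f"
  by (simp add: lterm_def)

lemma lterm_1: "lterm \<eta> (Suc 0) f = lie \<eta> f"
  by (simp add: lterm_def)

lemma lterm_add: "lterm \<eta> n (f + g) = lterm \<eta> n f + lterm \<eta> n g"
  by (simp add: lterm_def lie_pow_simps algebra_simps)

lemma lterm_Suc: "lterm \<eta> (Suc n) f = sconst (1 / real (Suc n)) * lie \<eta> (lterm \<eta> n f)"
  by (simp add: lterm_def mult.assoc[symmetric] sconst_simps(5)[symmetric] del: sconst_simps(5))

lemma lie_pow_wt: "\<eta> \<in> W 3 \<Longrightarrow> f \<in> W w \<Longrightarrow> (lie \<eta> ^^ n) f \<in> W (w + n)"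
  by (induction n) (auto intro: lie_wt_Suc)

lemma lterm_wt: "\<eta> \<in> W 3 \<Longrightarrow> f \<in> W w \<Longrightarrow> lterm \<eta> n f \<in> W (w + n)"
  unfolding lterm_def by (intro wt_sconst lie_pow_wt)

text \<open>\<open>lie \<eta>\<close> raises the weight by at least one, so the \<open>n\<close>-th
  term has weight at least \<open>w + n\<close> and only the terms with \<open>n < N\<close> reach
  this coefficient.\<close>

lemma cf_exp_lie:
  assumes "\<eta> \<in> W 3" "f \<in> W w" "k + l + 3 * m < w + N"
  shows "cf (exp_lie \<eta> f) k l m = (\<Sum>n<N. cf (lterm \<eta> n f) k l m)"
proof -
  have "cf ((lie \<eta> ^^ n) f) k l m / fact n = 0" if "n \<notin> {..<N}" for n
    using wtD[OF lie_pow_wt[OF assms(1,2)], of k l m n] that assms(3) by simp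
  then have "(\<Sum>n. cf ((lie \<eta> ^^ n) f) k l m / fact n) = (\<Sum>n<N. cf ((lie \<eta> ^^ n) f) k l m / fact n)"
    by (intro suminf_finite) auto
  then show ?thesis
    by (simp add: exp_lie_def lterm_def)
qed

lemma exp_lie_approx:
  assumes "\<eta> \<in> W 3" "f \<in> W w"
  shows "exp_lie \<eta> f - (\<Sum>n<N. lterm \<eta> n f) \<in> W (w + N)"
  by (rule wtI) (simp add: cf_exp_lie[OF assms])

lemma exp_lie_add:
  assumes "\<eta> \<in> W 3"
  shows "exp_lie \<eta> (f + g) = exp_lie \<eta> f + exp_lie \<eta> g"
proof (rule series_eqI)
  fix k l m
  show "cf (exp_lie \<eta> (f + g)) k l m = cf (exp_lie \<eta> f + exp_lie \<eta> g) k l m"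
    using cf_exp_lie[OF assms wt_zero[of _ 3], of k l m "Suc (k + l + 3 * m)"]
    by (simp add: lterm_add sum.distrib)
qed

lemma exp_lie_wt: "\<eta> \<in> W 3 \<Longrightarrow> f \<in> W w \<Longrightarrow> exp_lie \<eta> f \<in> W w"
  using exp_lie_approx[of \<eta> f w 0] by simp

lemma exp_lie_fixed:
  assumes "\<eta> \<in> W 3" "lie \<eta> f = 0"
  shows "exp_lie \<eta> f = f"
proof (rule series_eqI)
  fix k l m
  have "(lie \<eta> ^^ Suc n) f = 0" for n
    unfolding funpow_Suc_right using assms by (simp add: lie_pow_simps)
  then have "lterm \<eta> (Suc n) f = 0" for n
    by (simp add: lterm_def del: funpow.simps)
  then show "cf (exp_lie \<eta> f) k l m = cf f k l m"
    using cf_exp_lie[OF assms(1) wt_zero[of _ 3], of k l m "Suc (k + l + 3 * m)"]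
    by (simp add: sum.lessThan_Suc_shift del: sum.lessThan_Suc)
qed

lemma exp_lie_cadd: "\<eta> \<in> W 3 \<Longrightarrow> cadd (exp_lie \<eta>)"
  by (rule caddI[where c = 0]) (auto simp: exp_lie_add exp_lie_wt)

text \<open>Leibniz rule for the divided powers \<open>lterm\<close> of a derivation.
  \<open>B\<close> is left abstract because it serves as multiplication and as the Poisson
  bracket.\<close>

lemma lterm_bilinear:
  assumes add: "\<And>f f' g. B (f + f') g = B f g + B f' g" "\<And>f g g'. B f (g + g') = B f g + B f g'"
    and sc: "\<And>r f g. B (sconst r * f) g = sconst r * B f g" "\<And>r f g. B f (sconst r * g) = sconst r * B f g"
    and leib: "\<And>f g. lie \<eta> (B f g) = B (lie \<eta> f) g + B f (lie \<eta> g)"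
  shows "lterm \<eta> n (B f g) = (\<Sum>i\<le>n. B (lterm \<eta> i f) (lterm \<eta> (n - i) g))"
proof (induction n)
  case (Suc n)
  have *: "lie \<eta> (lterm \<eta> i h) = sconst (real (Suc i)) * lterm \<eta> (Suc i) h" for i h
    by (simp add: lterm_Suc mult.assoc[symmetric] sconst_simps(5)[symmetric] del: sconst_simps(5,4) of_nat_Suc)
  let ?t = "\<lambda>i. B (lterm \<eta> i f) (lterm \<eta> (Suc n - i) g)"
  have "sconst (real (Suc n)) * lterm \<eta> (Suc n) (B f g) = lie \<eta> (lterm \<eta> n (B f g))"
    by (simp only: *)
  also have "\<dots> = (\<Sum>i\<le>n. sconst (real (Suc i)) * ?t (Suc i)) +
      (\<Sum>i\<le>n. sconst (real (Suc (n - i))) * B (lterm \<eta> i f) (lterm \<eta> (Suc (n - i)) g))"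
    by (simp only: Suc lie_simps leib * sc sum.distrib diff_Suc_Suc)
  \<comment> \<open>Both sums are extended to \<open>i \<le> Suc n\<close> by a term with
    coefficient zero; the coefficients \<open>i\<close> and \<open>Suc n - i\<close> then add up to
    \<open>Suc n\<close>.\<close>
  also have "(\<Sum>i\<le>n. sconst (real (Suc i)) * ?t (Suc i)) = (\<Sum>i\<le>Suc n. sconst (real i) * ?t i)"
    unfolding sum.atMost_Suc_shift[of _ n] by simp
  also have "(\<Sum>i\<le>n. sconst (real (Suc (n - i))) * B (lterm \<eta> i f) (lterm \<eta> (Suc (n - i)) g)) =
      (\<Sum>i\<le>Suc n. sconst (real (Suc n - i)) * ?t i)"
    by (simp add: Suc_diff_le of_nat_diff add_diff_eq del: sconst_simps(4))
  also have "(\<Sum>i\<le>Suc n. sconst (real i) * ?t i) + \<dots> = (\<Sum>i\<le>Suc n. sconst (real (Suc n)) * ?t i)"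
    unfolding sum.distrib[symmetric]
    by (intro sum.cong refl)
      (simp only: distrib_right[symmetric] sconst_simps(4)[symmetric] of_nat_add[symmetric] atMost_iff
        le_add_diff_inverse)
  finally have "sconst (real (Suc n)) * lterm \<eta> (Suc n) (B f g) = sconst (real (Suc n)) * (\<Sum>i\<le>Suc n. ?t i)"
    by (simp only: sum_distrib_left)
  then have "sconst (1 / real (Suc n)) * (sconst (real (Suc n)) * lterm \<eta> (Suc n) (B f g)) =
    sconst (1 / real (Suc n)) * (sconst (real (Suc n)) * (\<Sum>i\<le>Suc n. ?t i))" by simp
  then show ?case
    by (simp only: mult.assoc[symmetric] sconst_simps(5)[symmetric]) (simp del: of_nat_Suc sum.atMost_Suc)
qed simp

lemma triangle_sum:
  fixes g :: "nat \<Rightarrow> nat \<Rightarrow> 'a :: comm_monoid_add"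
  shows "(\<Sum>n<N. \<Sum>i\<le>n. g i (n - i)) = (\<Sum>i<N. \<Sum>j<N - i. g i j)"
proof -
  have "(\<Sum>n<N. \<Sum>i\<le>n. g i (n - i)) = (\<Sum>(i, j)\<in>{(i, j). i + j < N}. g i j)"
    by (rule sum.triangle_reindex[symmetric])
  also have "{(i, j). i + j < N} = Sigma {..<N} (\<lambda>i. {..<N - i})" by auto
  finally show ?thesis by (simp add: sum.Sigma)
qed

text \<open>The truncated exponentials multiply as a Cauchy product over \<open>i + j < N\<close>,
  which \<open>lterm_bilinear\<close> sums; the remainders are small by \<open>w\<close>, which lets
  \<open>B\<close> lose up to two units of weight.\<close>

lemma exp_lie_bilinear:
  assumes \<eta>: "\<eta> \<in> W 3"
    and add: "\<And>f f' g. B (f + f') g = B f g + B f' g" "\<And>f g g'. B f (g + g') = B f g + B f g'"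
    and sc: "\<And>r f g. B (sconst r * f) g = sconst r * B f g" "\<And>r f g. B f (sconst r * g) = sconst r * B f g"
    and leib: "\<And>f g. lie \<eta> (B f g) = B (lie \<eta> f) g + B f (lie \<eta> g)"
    and w: "\<And>f g i j n. f \<in> W i \<Longrightarrow> g \<in> W j \<Longrightarrow> n + 2 \<le> i + j \<Longrightarrow> B f g \<in> W n"
  shows "exp_lie \<eta> (B f g) = B (exp_lie \<eta> f) (exp_lie \<eta> g)"
proof -
  have B0: "B 0 g = 0" "B f 0 = 0" for f g
    using add(1)[of 0 0] add(2)[of _ 0 0] by auto
  have Bs: "B (sum h A) g = (\<Sum>i\<in>A. B (h i) g)" "B g (sum h A) = (\<Sum>i\<in>A. B g (h i))"
    for h :: "nat \<Rightarrow> series" and A g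
    by (induction A rule: infinite_finite_induct) (auto simp: add B0)
  have "exp_lie \<eta> (B f g) - B (exp_lie \<eta> f) (exp_lie \<eta> g) \<in> W n" for n
  proof -
    \<comment> \<open>The extra two compensates the weight lost by \<open>B\<close>. The second
      factor is cut at \<open>N - i\<close> because \<open>lterm \<eta> i f\<close> already has
      weight at least \<open>i\<close>.\<close>
    define N where "N = n + 2"
    define r where "r = exp_lie \<eta> f - (\<Sum>i<N. lterm \<eta> i f)"
    define s where "s = (\<lambda>i. exp_lie \<eta> g - (\<Sum>j<N - i. lterm \<eta> j g))"
    have r: "r \<in> W N" and s: "s i \<in> W (N - i)" for i
      using exp_lie_approx[OF \<eta> wt_zero, of _ N] exp_lie_approx[OF \<eta> wt_zero, of _ "N - i"]
      by (simp_all add: r_def s_def)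
    have "B (exp_lie \<eta> f) (exp_lie \<eta> g) = B (r + (\<Sum>i<N. lterm \<eta> i f)) (exp_lie \<eta> g)"
      by (simp add: r_def)
    also have "\<dots> = B r (exp_lie \<eta> g) + (\<Sum>i<N. B (lterm \<eta> i f) (s i + (\<Sum>j<N - i. lterm \<eta> j g)))"
      by (simp add: add Bs s_def)
    also have "\<dots> = B r (exp_lie \<eta> g) + (\<Sum>i<N. B (lterm \<eta> i f) (s i)) +
      (\<Sum>i<N. \<Sum>j<N - i. B (lterm \<eta> i f) (lterm \<eta> j g))"
      by (simp only: add Bs sum.distrib add.assoc)
    also have "(\<Sum>i<N. \<Sum>j<N - i. B (lterm \<eta> i f) (lterm \<eta> j g)) = (\<Sum>n<N. lterm \<eta> n (B f g))"
      by (simp only: triangle_sum[symmetric] lterm_bilinear[OF add sc leib])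
    finally have eq: "exp_lie \<eta> (B f g) - B (exp_lie \<eta> f) (exp_lie \<eta> g) =
      (exp_lie \<eta> (B f g) - (\<Sum>n<N. lterm \<eta> n (B f g))) - B r (exp_lie \<eta> g) -
      (\<Sum>i<N. B (lterm \<eta> i f) (s i))"
      by (simp add: algebra_simps)
    have "exp_lie \<eta> (B f g) - (\<Sum>n<N. lterm \<eta> n (B f g)) \<in> W n"
      using exp_lie_approx[OF \<eta> wt_zero, of "B f g" N] by (rule wt_mono) (simp add: N_def)
    moreover have "B r (exp_lie \<eta> g) \<in> W n"
      by (rule w[OF r wt_zero]) (simp add: N_def)
    moreover have "B (lterm \<eta> i f) (s i) \<in> W n" if "i < N" for i
      using that by (intro w[OF lterm_wt[OF \<eta> wt_zero] s]) (simp add: N_def)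
    ultimately show ?thesis
      unfolding eq by (rule wt_diff[OF wt_diff wt_sum]) simp
  qed
  then have "exp_lie \<eta> (B f g) - B (exp_lie \<eta> f) (exp_lie \<eta> g) = 0" by (rule wt_eq_0)
  then show ?thesis by simp
qed

lemma exp_lie_mult: "\<eta> \<in> W 3 \<Longrightarrow> exp_lie \<eta> (f * g) = exp_lie \<eta> f * exp_lie \<eta> g"
proof (rule exp_lie_bilinear)
  show "lie \<eta> (f * g) = lie \<eta> f * g + f * lie \<eta> g" for f g
    by (simp add: lie_def poisson_mult_left)
  show "f * g \<in> W n" if "f \<in> W i" "g \<in> W j" "n + 2 \<le> i + j" for f g n i j
    by (rule wt_mult_le[OF that(1,2)]) (use that in simp)
qed (simp_all add: algebra_simps)

lemma exp_lie_poisson: "\<eta> \<in> W 3 \<Longrightarrow> poisson (exp_lie \<eta> f) (exp_lie \<eta> g) = exp_lie \<eta> (poisson f g)"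
proof (rule exp_lie_bilinear[symmetric])
  show "lie \<eta> (poisson f g) = poisson (lie \<eta> f) g + poisson f (lie \<eta> g)" for f g
    unfolding lie_def by (rule poisson_jacobi)
qed (simp_all add: poisson_simps poisson_wt)

lemma exp_lie_shom:
  assumes "\<eta> \<in> W 3"
  shows "shom (exp_lie \<eta>)"
proof -
  have "exp_lie \<eta> (sconst r) = sconst r" "exp_lie \<eta> sE = sE" for r
    by (rule exp_lie_fixed[OF assms]; simp add: lie_def poisson_def)+
  then show ?thesis
    by (simp add: shom_def exp_lie_add exp_lie_mult exp_lie_wt assms)
qed

lemma shom_lterm:
  assumes "shom T" "\<And>f. T (lie \<eta> f) = lie \<eta>' (T f)"
  shows "T (lterm \<eta> n f) = lterm \<eta>' n (T f)"
proof -
  have "T ((lie \<eta> ^^ n) f) = (lie \<eta>' ^^ n) (T f)"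
    by (induction n) (auto simp: assms)
  then show ?thesis by (simp add: lterm_def shomD[OF assms(1)])
qed

text \<open>A substitution intertwining two derivations intertwines their truncated exponentials,
  and the remainders have arbitrarily high weight. It is applied to \<open>D\<close> and to
  canonical maps with the transported Hamiltonian.\<close>

lemma shom_exp_lie:
  assumes T: "shom T" and \<eta>: "\<eta> \<in> W 3" "\<eta>' \<in> W 3" and L: "\<And>f. T (lie \<eta> f) = lie \<eta>' (T f)"
  shows "T (exp_lie \<eta> f) = exp_lie \<eta>' (T f)"
proof -
  have "T (exp_lie \<eta> f) - exp_lie \<eta>' (T f) \<in> W N" for N
  proof -
    have 1: "T (exp_lie \<eta> f - (\<Sum>n<N. lterm \<eta> n f)) \<in> W N"
      using exp_lie_approx[OF \<eta>(1) wt_zero, of f N] by (intro shomD(5)[OF T]) simp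
    have 2: "exp_lie \<eta>' (T f) - (\<Sum>n<N. lterm \<eta>' n (T f)) \<in> W N"
      using exp_lie_approx[OF \<eta>(2) wt_zero, of "T f" N] by simp
    show ?thesis
      using wt_diff[OF 1 2] by (simp add: shom_simps[OF T] shom_lterm[OF T L])
  qed
  then have "T (exp_lie \<eta> f) - exp_lie \<eta>' (T f) = 0" by (rule wt_eq_0)
  then show ?thesis by simp
qed

text \<open>Collecting the double series by total order \<open>n\<close> produces the coefficients
  of exp(-t) exp(t) = 1, so only the term \<open>n = 0\<close> survives.\<close>

lemma exp_lie_inverse:
  assumes \<eta>: "\<eta> \<in> W 3"
  shows "exp_lie (- \<eta>) (exp_lie \<eta> f) = f"
proof -
  have \<eta>': "- \<eta> \<in> W 3" using \<eta> by auto
  define c :: "nat \<Rightarrow> nat \<Rightarrow> real" where "c = (\<lambda>i j. (- 1) ^ i / (fact i * fact j))"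
  have neg: "(lie (- \<eta>) ^^ n) g = sconst ((- 1) ^ n) * (lie \<eta> ^^ n) g" for n g
    by (induction n) (simp_all add: lie_def poisson_simps)
  have lt: "lterm (- \<eta>) i (lterm \<eta> j f) = sconst (c i j) * (lie \<eta> ^^ (i + j)) f" for i j
    unfolding lterm_def neg lie_pow_simps funpow_add o_def c_def
    by (simp only: mult.assoc[symmetric] sconst_simps(5)[symmetric]) (simp add: field_simps)
  have cs: "(\<Sum>i\<le>n. c i (n - i)) = (if n = 0 then 1 else 0)" for n
  proof -
    have "(\<Sum>i\<le>n. c i (n - i)) = fps_nth (fps_exp (- 1) * fps_exp 1) n"
      by (simp add: fps_mult_nth c_def atMost_atLeast0)
    also have "\<dots> = (if n = 0 then 1 else 0)"
      unfolding fps_exp_add_mult[symmetric] by simp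
    finally show ?thesis .
  qed
  have ss: "sum (\<lambda>i. sconst (h i)) A = sconst (sum h A)" for h :: "nat \<Rightarrow> real" and A
    by (induction A rule: infinite_finite_induct) auto
  have "exp_lie (- \<eta>) (exp_lie \<eta> f) - f \<in> W N" if "N > 0" for N
  proof -
    define r where "r = exp_lie \<eta> f - (\<Sum>j<N. lterm \<eta> j f)"
    have r: "r \<in> W N"
      using exp_lie_approx[OF \<eta> wt_zero, of f N] by (simp add: r_def)
    have e: "exp_lie (- \<eta>) (lterm \<eta> j f) - (\<Sum>i<N - j. lterm (- \<eta>) i (lterm \<eta> j f)) \<in> W N" if "j < N" for j
      using exp_lie_approx[OF \<eta>' lterm_wt[OF \<eta> wt_zero], of j f "N - j"] that by simp
    have "(\<Sum>j<N. \<Sum>i<N - j. lterm (- \<eta>) i (lterm \<eta> j f)) =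
      (\<Sum>n<N. \<Sum>j\<le>n. lterm (- \<eta>) (n - j) (lterm \<eta> j f))"
      by (rule triangle_sum[symmetric])
    also have "\<dots> = (\<Sum>n<N. sconst (\<Sum>j\<le>n. c (n - j) j) * (lie \<eta> ^^ n) f)"
      by (simp add: lt sum_distrib_right ss[symmetric])
    also have "\<dots> = (\<Sum>n<N. if n = 0 then f else 0)"
    proof (rule sum.cong[OF refl])
      fix n
      have "(\<Sum>j\<le>n. c (n - j) j) = (\<Sum>i\<le>n. c i (n - i))"
        using sum.nat_diff_reindex[of "\<lambda>i. c i (n - i)" "Suc n"]
        by (simp add: lessThan_Suc_atMost)
      then show "sconst (\<Sum>j\<le>n. c (n - j) j) * (lie \<eta> ^^ n) f = (if n = 0 then f else 0)"
        by (simp add: cs)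
    qed
    also have "\<dots> = f" using that by simp
    finally have main: "(\<Sum>j<N. \<Sum>i<N - j. lterm (- \<eta>) i (lterm \<eta> j f)) = f" .
    have "exp_lie (- \<eta>) (exp_lie \<eta> f) = exp_lie (- \<eta>) (r + (\<Sum>j<N. lterm \<eta> j f))"
      by (simp add: r_def)
    also have "\<dots> = exp_lie (- \<eta>) r + (\<Sum>j<N. exp_lie (- \<eta>) (lterm \<eta> j f))"
      by (simp only: exp_lie_add[OF \<eta>'] cadd_sum[OF exp_lie_cadd[OF \<eta>']])
    finally have "exp_lie (- \<eta>) (exp_lie \<eta> f) - f = exp_lie (- \<eta>) r +
      (\<Sum>j<N. exp_lie (- \<eta>) (lterm \<eta> j f) - (\<Sum>i<N - j. lterm (- \<eta>) i (lterm \<eta> j f)))"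
      by (simp add: sum_subtractf main)
    then show ?thesis
      using exp_lie_wt[OF \<eta>' r] e by (auto intro!: wt_add wt_sum)
  qed
  then have "exp_lie (- \<eta>) (exp_lie \<eta> f) - f \<in> W N" for N
    by (rule wt_mono[of _ _ "Suc N"]) auto
  then have "exp_lie (- \<eta>) (exp_lie \<eta> f) - f = 0" by (rule wt_eq_0)
  then show ?thesis by simp
qed

lemma time_one:
  assumes "\<eta> \<in> W 3"
  shows "fixes_origin (time_one \<eta>)" "pull (time_one \<eta>) f = exp_lie \<eta> f" "canonical (time_one \<eta>)"
proof -
  note T = exp_lie_shom[OF assms]
  show 0: "fixes_origin (time_one \<eta>)"
    using shom_gen_wt[OF T] by (simp only: fixes_origin_def time_one_def W1_iff fst_conv snd_conv)
  show 1: "pull (time_one \<eta>) f = exp_lie \<eta> f" for f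
    unfolding pull_def time_one_def fst_conv snd_conv by (rule shom_psubst[OF T, symmetric])
  show "canonical (time_one \<eta>)"
    by (rule canonicalI[OF 0])
      (simp only: 1 exp_lie_poisson[OF assms], simp add: poisson_def shom_simps[OF T])
qed

lemma time_one_inverse:
  assumes "\<eta> \<in> W 3"
  shows "is_inverse (time_one (- \<eta>)) (time_one \<eta>)"
proof -
  have \<eta>': "- \<eta> \<in> W 3" using assms by auto
  note t = time_one[OF assms] time_one[OF \<eta>']
  show ?thesis
    unfolding is_inverse_def
    using exp_lie_inverse[OF assms] exp_lie_inverse[OF \<eta>']
    by (intro conjI t pull_inject pull_fcomp fid) (simp_all add: pull_fcomp t fid)
qed

section \<open>Diagonal maps and parity in x\<close>

text \<open>One family covers \<open>D\<close>, with \<open>s = - 1\<close> and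
  \<open>t = 1\<close>, and the area-preserving scalings, with \<open>s * t = 1\<close>, that
  normalise the coefficient of \<open>x y^2\<close>.\<close>

definition diag :: "real \<Rightarrow> real \<Rightarrow> fmap" where
  "diag s t = (sconst s * sX, sconst t * sY)"

lemma diag: "fixes_origin (diag s t)" "pull (diag s t) sX = sconst s * sX"
  "pull (diag s t) sY = sconst t * sY"
proof -
  show 0: "fixes_origin (diag s t)" by (simp add: fixes_origin_def diag_def cf_gen)
  show "pull (diag s t) sX = sconst s * sX" "pull (diag s t) sY = sconst t * sY"
    using pull_gen[OF 0] by (simp_all add: diag_def)
qed

lemma cf_diag: "cf (pull (diag s t) f) k l m = s ^ k * t ^ l * cf f k l m"
proof -
  let ?S = "\<lambda>f. mk_series (\<lambda>k l m. s ^ k * t ^ l * cf f k l m)"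
  note T = pull_shom[OF diag(1), of s t]
  have sconst_power: "sconst r ^ n = sconst (r ^ n)" for r n
    by (induction n) simp_all
  have "pull (diag s t) f = ?S f"
  proof (rule cadd_ext[of "pull (diag s t)"])
    show "cadd (pull (diag s t))" by (rule shom_cadd[OF T])
    show "cadd ?S"
      by (rule caddI[where c = 0]) (auto intro!: series_eqI wtI simp: algebra_simps wtD)
    show "pull (diag s t) (sconst r * mon i j p) = ?S (sconst r * mon i j p)" for r i j p
    proof (rule series_eqI)
      fix k l m
      have "pull (diag s t) (sconst r * mon i j p) =
        sconst r * (sconst (s ^ i) * (sconst (t ^ j) * mon i j p))"
        unfolding mon_def
        by (simp add: shomD[OF T] shom_simps[OF T] diag power_mult_distrib sconst_power algebra_simps)
      then show "cf (pull (diag s t) (sconst r * mon i j p)) k l m = cf (?S (sconst r * mon i j p)) k l m"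
        by (simp add: cf_mon)
    qed
  qed
  then show ?thesis by simp
qed

lemma Dmap_diag: "Dmap = diag (- 1) 1"
  by (simp add: Dmap_def diag_def)

lemma Dmap: "fixes_origin Dmap" "pull Dmap sX = - sX" "pull Dmap sY = sY"
  by (simp_all add: Dmap_diag diag)

lemmas Dmap_shom = pull_shom[OF Dmap(1)]

lemma cf_Dmap: "cf (pull Dmap f) k l m = (- 1) ^ k * cf f k l m"
  by (simp add: Dmap_diag cf_diag)

lemma Dmap_Dmap: "pull Dmap (pull Dmap f) = f"
  by (rule series_eqI) (simp add: cf_Dmap mult.assoc[symmetric] power_add[symmetric])

lemma odd_in_x_pull: "odd_in_x f \<longleftrightarrow> pull Dmap f = - f"
  by (simp add: odd_in_x_def pull_def Dmap_def)

lemma odd_in_x_cf: "odd_in_x f \<longleftrightarrow> (\<forall>k l m. even k \<longrightarrow> cf f k l m = 0)"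
proof
  assume "odd_in_x f"
  then have "cf (pull Dmap f) k l m = cf (- f) k l m" for k l m
    by (simp add: odd_in_x_pull)
  then show "\<forall>k l m. even k \<longrightarrow> cf f k l m = 0"
    by (auto simp: cf_Dmap) (metis minus_one_power_iff mult_1 equal_neg_zero)
next
  assume "\<forall>k l m. even k \<longrightarrow> cf f k l m = 0"
  then show "odd_in_x f"
    by (auto simp: odd_in_x_pull cf_Dmap minus_one_power_iff intro!: series_eqI)
qed

lemma odd_in_x_simps:
  "odd_in_x 0" "odd_in_x f \<Longrightarrow> odd_in_x g \<Longrightarrow> odd_in_x (f + g)"
  "odd_in_x f \<Longrightarrow> odd_in_x g \<Longrightarrow> odd_in_x (f - g)" "odd_in_x f \<Longrightarrow> odd_in_x (- f)"
  "odd_in_x f \<Longrightarrow> odd_in_x (sconst r * f)"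
  by (simp_all add: odd_in_x_cf)

lemma Dmap_poisson: "poisson (pull Dmap f) (pull Dmap g) = - pull Dmap (poisson f g)"
proof -
  have "jac (- sX, sY) = - 1" by (simp add: jac_def)
  then show ?thesis
    unfolding pull_def Dmap_def fst_conv snd_conv
    by (subst psubst_poisson) (simp_all add: cf_gen)
qed

text \<open>\<open>D\<close> reverses the bracket and an odd Hamiltonian changes sign under
  \<open>D\<close>; the two signs cancel. Hence the flow of an odd Hamiltonian commutes with
  \<open>D\<close>.\<close>

lemma Dmap_lie: "odd_in_x \<eta> \<Longrightarrow> pull Dmap (lie \<eta> f) = lie \<eta> (pull Dmap f)"
  using Dmap_poisson[of f \<eta>] by (simp add: odd_in_x_pull lie_def poisson_simps)

lemma Dmap_exp_lie:
  "\<eta> \<in> W 3 \<Longrightarrow> odd_in_x \<eta> \<Longrightarrow> pull Dmap (exp_lie \<eta> f) = exp_lie \<eta> (pull Dmap f)"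
  by (rule shom_exp_lie[OF Dmap_shom]) (simp_all add: Dmap_lie)

lemma odd_in_x_lie: "odd_in_x \<eta> \<Longrightarrow> odd_in_x f \<Longrightarrow> odd_in_x (lie \<eta> f)"
  by (simp add: odd_in_x_pull[of f] odd_in_x_pull[of "lie \<eta> f"] Dmap_lie)

lemma odd_in_x_exp_lie: "\<eta> \<in> W 3 \<Longrightarrow> odd_in_x \<eta> \<Longrightarrow> odd_in_x f \<Longrightarrow> odd_in_x (exp_lie \<eta> f)"
  by (simp add: odd_in_x_pull[of f] odd_in_x_pull[of "exp_lie \<eta> f"] Dmap_exp_lie
      shom_simps[OF exp_lie_shom])

section \<open>The homological equation\<close>

definition h3 :: "real \<Rightarrow> series" where
  "h3 a = sX * sY ^ 2 + sconst a * sX ^ 3"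

lemma cf_h3: "cf (h3 a) k l m =
  (if k = 1 \<and> l = 2 \<and> m = 0 then 1 else if k = 3 \<and> l = 0 \<and> m = 0 then a else 0)"
proof -
  have "h3 a = mon 1 2 0 + sconst a * mon 3 0 0" by (simp add: h3_def mon_def)
  then show ?thesis by (simp add: cf_mon)
qed

lemma h3_wt: "h3 a \<in> W 3"
  by (rule wtI) (auto simp: cf_h3)

lemma h3_odd: "odd_in_x (h3 a)"
  by (auto simp: odd_in_x_cf cf_h3)

text \<open>The split by the \<open>y\<close>-exponent separates the coefficients at
  \<open>y^0\<close>, which carry no diagonal term, from the others, where \<open>x y^2\<close>
  contributes the diagonal factor \<open>2 i - j\<close>.\<close>

lemma cf_lie_h3:
  "cf (lie (h3 a) \<chi>) i 0 m = - (3 * a) * (if i \<ge> 2 then cf \<chi> (i - 2) 1 m else 0)"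
  "cf (lie (h3 a) \<chi>) i (Suc j) m = (2 * real i - real j) * cf \<chi> i j m -
     3 * a * (real j + 2) * (if i \<ge> 2 then cf \<chi> (i - 2) (j + 2) m else 0)"
proof -
  have pd: "pd_x (h3 a) = sY ^ 2 + sconst (3 * a) * sX ^ 2" "pd_y (h3 a) = sconst 2 * sX * sY"
  proof -
    have 3: "(3 :: series) = sconst 1 + sconst 1 + sconst 1" "(2 :: series) = sconst 1 + sconst 1"
      by simp_all
    show "pd_x (h3 a) = sY ^ 2 + sconst (3 * a) * sX ^ 2" "pd_y (h3 a) = sconst 2 * sX * sY"
      using sconst_simps(4)[of 1 1] sconst_simps(4)[of 2 1]
      by (simp_all add: h3_def pd_x_mult pd_y_mult power2_eq_square power3_eq_cube algebra_simps)
  qed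
  have "lie (h3 a) \<chi> = sconst 2 * (sX * (sY * pd_x \<chi>)) - sY ^ 2 * pd_y \<chi> -
    sconst (3 * a) * (sX ^ 2 * pd_y \<chi>)"
    unfolding lie_def poisson_def pd by (simp add: algebra_simps)
  then have *: "cf (lie (h3 a) \<chi>) i l m = 2 * cf (sX * (sY * pd_x \<chi>)) i l m
    - cf (sY ^ 2 * pd_y \<chi>) i l m - 3 * a * cf (sX ^ 2 * pd_y \<chi>) i l m" for l
    by (simp only: cf_diff cf_sconst_mult)
  show "cf (lie (h3 a) \<chi>) i 0 m = - (3 * a) * (if i \<ge> 2 then cf \<chi> (i - 2) 1 m else 0)"
    unfolding * cf_sX_power_mult cf_sY_power_mult cf_sX_mult cf_sY_mult
    by (simp split: nat.split)
  show "cf (lie (h3 a) \<chi>) i (Suc j) m = (2 * real i - real j) * cf \<chi> i j m -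
     3 * a * (real j + 2) * (if i \<ge> 2 then cf \<chi> (i - 2) (j + 2) m else 0)"
    unfolding * cf_sX_power_mult cf_sY_power_mult cf_sX_mult cf_sY_mult
    by (cases i; cases j) (auto simp: algebra_simps)
qed

text \<open>The exponents out of reach of the diagonal part of the bracket with \<open>h3 a\<close>:
  \<open>j = 0\<close>, and \<open>j = 2 * i + 1\<close>, where the factor
  \<open>2 i - (j - 1)\<close> vanishes. These are the monomials of \<open>A\<close> and
  \<open>y B\<close>, apart from the weight bound on \<open>A\<close>.\<close>

definition normal_shape :: "series \<Rightarrow> bool" where
  "normal_shape N \<longleftrightarrow> (\<forall>i j m. cf N i j m \<noteq> 0 \<longrightarrow> odd i \<and> (j = 0 \<or> j = 2 * i + 1))"

text \<open>
  The coefficients of the solution \<open>\<chi>\<close>, read off from \<open>cf_lie_h3\<close> by recursion on the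
  \<open>x\<close>-exponent.  The resonant ones, \<open>j = 2 i\<close>, are free and set to 0.
\<close>

fun hom_coeff :: "real \<Rightarrow> series \<Rightarrow> nat \<Rightarrow> nat \<Rightarrow> nat \<Rightarrow> real" where
  "hom_coeff a G 0 j m = 0"
| "hom_coeff a G (Suc 0) j m = (if j = 2 then 0 else - cf G 1 (Suc j) m / (2 - real j))"
| "hom_coeff a G (Suc (Suc i)) j m = (if j = 2 * i + 4 then 0 else
     (3 * a * (real j + 2) * hom_coeff a G i (j + 2) m - cf G (i + 2) (Suc j) m) / (2 * real i + 4 - real j))"

lemma homological_equation:
  assumes "odd_in_x G" "G \<in> W (Suc n)"
  obtains \<chi> N where "odd_in_x \<chi>" "\<chi> \<in> W n" "normal_shape N" "N \<in> W (Suc n)" "G = N + lie \<chi> (h3 a)"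
proof -
  define \<chi> where "\<chi> = mk_series (hom_coeff a G)"
  define N where "N = G + lie (h3 a) \<chi>"
  have ev: "hom_coeff a G i j m = 0" if "even i" for i j m
    using that assms(1) by (induction a G i j m rule: hom_coeff.induct) (auto simp: odd_in_x_cf)
  then have odd: "odd_in_x \<chi>" by (simp add: odd_in_x_cf \<chi>_def)
  \<comment> \<open>The recursion passes from \<open>(i, j)\<close> to \<open>(i - 2, j + 2)\<close>
    at equal weight, and uses the coefficient of \<open>G\<close> at \<open>y\<close>-exponent
    \<open>j + 1\<close>, of weight one more; this matches \<open>n\<close> against
    \<open>Suc n\<close>.\<close>
  have "hom_coeff a G i j m = 0" if "i + j + 3 * m < n" for i j m
    using that assms(2) by (induction a G i j m rule: hom_coeff.induct) (auto simp: wtD)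
  then have wt: "\<chi> \<in> W n" by (auto intro: wtI simp: \<chi>_def)
  have N_odd: "odd_in_x N"
    unfolding N_def by (intro odd_in_x_simps assms odd_in_x_lie odd h3_odd)
  \<comment> \<open>Off resonance, each clause of \<open>hom_coeff\<close> solves the equation that
    this coefficient of \<open>N\<close> vanishes; hence the case split along the clauses.\<close>
  have "cf N i (Suc j) m = 0" if "j \<noteq> 2 * i" for i j m
  proof (cases "(a, G, i, j, m)" rule: hom_coeff.cases)
    case (1 a' G' j' m')
    then show ?thesis using N_odd by (simp add: odd_in_x_cf)
  next
    case (2 a' G' j' m')
    then show ?thesis using that by (simp add: N_def cf_lie_h3 \<chi>_def field_simps)
  next
    case (3 a' G' i' j' m')
    then have "2 * real i' + 4 - real j \<noteq> 0" using that by auto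
    then show ?thesis using 3 that by (simp add: N_def cf_lie_h3 \<chi>_def field_simps)
  qed
  then have N: "normal_shape N"
    using N_odd unfolding normal_shape_def odd_in_x_cf
    by (metis Suc_eq_plus1 not0_implies_Suc)
  have "N \<in> W (Suc n)"
    unfolding N_def using lie_wt_Suc[OF h3_wt wt] assms(2) by (rule wt_add[rotated])
  moreover have "G = N + lie \<chi> (h3 a)"
    using poisson_antisym[of \<chi> "h3 a"] by (simp add: N_def lie_def)
  ultimately show ?thesis using that odd wt N by blast
qed

text \<open>In weight \<open>n\<close>, by induction on \<open>i\<close>, a coefficient of
  \<open>\<chi>\<close> with \<open>i\<close> odd and \<open>j \<noteq> 2 * i\<close> satisfies
  \<open>(2 i - j) * cf \<chi> i j m = 0\<close>, because \<open>N\<close> has no monomial at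
  \<open>y\<close>-exponent \<open>j + 1\<close>. The resonant coefficients have weight
  \<open>3 i + 3 m\<close> and vanish by \<open>res\<close>.\<close>

lemma homological_unique:
  assumes \<chi>: "odd_in_x \<chi>" "\<chi> \<in> W n" and N: "normal_shape N"
    and eq: "N - lie \<chi> (h3 a) \<in> W (n + 2)"
    and res: "\<And>i m. odd i \<Longrightarrow> 3 * i + 3 * m = n \<Longrightarrow> cf \<chi> i (2 * i) m = 0"
  shows "\<chi> \<in> W (Suc n)" "N \<in> W (n + 2)"
proof -
  have eq': "N + lie (h3 a) \<chi> \<in> W (n + 2)"
    using eq poisson_antisym[of \<chi> "h3 a"] by (simp add: lie_def)
  have 0: "cf \<chi> i j m = 0" if "i + j + 3 * m = n" for i j m
    using that
  proof (induction i arbitrary: j rule: less_induct)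
    case (less i)
    show ?case
    proof (cases "odd i \<and> j \<noteq> 2 * i")
      case True
      have "(if i \<ge> 2 then cf \<chi> (i - 2) (j + 2) m else 0) = 0"
        using less by auto
      moreover have "cf (N + lie (h3 a) \<chi>) i (Suc j) m = 0"
        using eq' less.prems by (intro wtD) auto
      moreover have "cf N i (Suc j) m = 0"
        using N True by (auto simp: normal_shape_def)
      ultimately have "(2 * real i - real j) * cf \<chi> i j m = 0"
        by (simp add: cf_lie_h3)
      moreover have "2 * real i - real j \<noteq> 0" using True by linarith
      ultimately show ?thesis by simp
    next
      case False
      then show ?thesis
        using \<chi>(1) res[of i m] less.prems by (cases "odd i") (auto simp: odd_in_x_cf)
    qed
  qed
  show *: "\<chi> \<in> W (Suc n)"
    using 0 wtD[OF \<chi>(2)] by (auto intro!: wtI simp: less_Suc_eq)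
  have "lie (h3 a) \<chi> \<in> W (n + 2)"
    using lie_wt_Suc[OF h3_wt *] by simp
  then have "(N + lie (h3 a) \<chi>) - lie (h3 a) \<chi> \<in> W (n + 2)"
    using eq' by (rule wt_diff[rotated])
  then show "N \<in> W (n + 2)" by simp
qed

section \<open>The kernel of the bracket with the leading Hamiltonian\<close>

lemma cf_h3_power:
  "k < i \<Longrightarrow> cf (h3 a ^ i) k l m = 0" "m > 0 \<Longrightarrow> cf (h3 a ^ i) k l m = 0"
  "cf (h3 a ^ i) i (2 * i) 0 = 1"
proof -
  \<comment> \<open>Each factor contributes \<open>x y^2\<close> or \<open>a x^3\<close>, so
    \<open>x^i\<close> arises only by choosing \<open>x y^2\<close> in all \<open>i\<close>
    factors.\<close>
  have step: "h3 a ^ Suc i = sX * (sY ^ 2 * h3 a ^ i) + sconst a * (sX ^ 3 * h3 a ^ i)" for i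
    by (simp add: h3_def algebra_simps)
  show A: "k < i \<Longrightarrow> cf (h3 a ^ i) k l m = 0" for k i l m
  proof (induction i arbitrary: k l)
    case (Suc i)
    then show ?case unfolding step by (auto simp: cf_sX_power_mult cf_sY_power_mult cf_sX_mult split: nat.split)
  qed simp
  show "m > 0 \<Longrightarrow> cf (h3 a ^ i) k l m = 0"
  proof (induction i arbitrary: k l)
    case (Suc i)
    then show ?case unfolding step by (auto simp: cf_sX_power_mult cf_sY_power_mult cf_sX_mult split: nat.split)
  qed (simp add: cf_1)
  show "cf (h3 a ^ i) i (2 * i) 0 = 1"
  proof (induction i)
    case (Suc i)
    then show ?case
      unfolding step using A[of "i - 2" i] by (auto simp: cf_sX_power_mult cf_sY_power_mult cf_sX_mult)
  qed (simp add: cf_1)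
qed

lemma power_diff_wt:
  assumes "f \<in> W w" "g \<in> W w" "f - g \<in> W (w + d)"
  shows "f ^ n - g ^ n \<in> W (n * w + d)"
proof (induction n)
  case (Suc n)
  have "f ^ Suc n - g ^ Suc n = f * (f ^ n - g ^ n) + (f - g) * g ^ n"
    by (simp add: algebra_simps)
  moreover have "f * (f ^ n - g ^ n) \<in> W (Suc n * w + d)"
    by (rule wt_mult_le[OF assms(1) Suc]) simp
  moreover have "(f - g) * g ^ n \<in> W (Suc n * w + d)"
    by (rule wt_mult_le[OF assms(3) wt_power[OF assms(2)]]) simp
  ultimately show ?case by (simp only: wt_add)
qed simp

text \<open>Polynomials in \<open>h\<close> and \<open>\<epsilon>\<close> commute with
  \<open>h\<close>. A combination of the \<open>\<epsilon>^m h^i\<close> with \<open>i\<close> odd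
  and \<open>3 i + 3 m = n\<close> has weight \<open>n\<close>, and its coefficients can be chosen
  to reproduce the resonant coefficients of \<open>\<chi>\<close> in that weight.\<close>

lemma kernel_element:
  assumes h: "h - h3 a \<in> W 4" "odd_in_x h" and \<chi>: "\<chi> \<in> W n"
  obtains \<kappa> where "odd_in_x \<kappa>" "\<kappa> \<in> W n" "lie \<kappa> h = 0"
    "\<And>i m. odd i \<Longrightarrow> 3 * i + 3 * m = n \<Longrightarrow> cf \<kappa> i (2 * i) m = cf \<chi> i (2 * i) m"
proof -
  define S where "S = {(i, m). odd i \<and> 3 * i + 3 * m = n}"
  have fin: "finite S"
    by (rule finite_subset[of _ "{..n} \<times> {..n}"]) (auto simp: S_def)
  define t where "t = (\<lambda>(i, m). sconst (cf \<chi> i (2 * i) m) * (sE ^ m * h ^ i))"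
  define \<kappa> where "\<kappa> = sum t S"
  have hw: "h \<in> W 3"
    using wt_add[OF wt_mono[OF h(1), of 3] h3_wt[of a]] by simp
  have "odd_in_x (t s)" if "s \<in> S" for s
    using that h(2)
    by (auto simp: S_def t_def odd_in_x_pull shomD[OF Dmap_shom] shom_simps[OF Dmap_shom] power_minus_odd)
  then have 1: "odd_in_x \<kappa>" by (auto simp: \<kappa>_def odd_in_x_cf)
  have "t (i, m) \<in> W n" if "(i, m) \<in> S" for i m
  proof -
    have "sE ^ m * h ^ i \<in> W (m * 3 + i * 3)"
      by (intro wt_mult wt_power wt_gen hw)
    then have "sE ^ m * h ^ i \<in> W n"
      using that by (simp add: S_def mult.commute add.commute)
    then show ?thesis by (auto simp: t_def)
  qed
  then have 2: "\<kappa> \<in> W n" unfolding \<kappa>_def by (auto intro: wt_sum)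
  have hp: "poisson h (h ^ i) = 0" for i
  proof (induction i)
    case (Suc i)
    have "poisson h h = 0" by (simp add: poisson_def)
    with Suc show ?case by (simp add: poisson_mult_right)
  qed (simp add: poisson_def)
  have Ep: "poisson h (sE ^ m) = 0" for m
  proof (induction m)
    case (Suc m)
    have "poisson h sE = 0" by (simp add: poisson_def)
    with Suc show ?case by (simp add: poisson_mult_right)
  qed (simp add: poisson_def)
  have "poisson h (sconst r) = 0" for r by (simp add: poisson_def)
  then have "poisson h (t s) = 0" for s
    by (cases s) (simp only: t_def split poisson_simps(8) poisson_mult_right hp Ep mult_zero_left
        mult_zero_right add_0_right)
  then have 3: "lie \<kappa> h = 0" by (simp add: lie_def \<kappa>_def poisson_sum_right)
  have 4: "cf \<kappa> i (2 * i) m = cf \<chi> i (2 * i) m" if im: "odd i" "3 * i + 3 * m = n" for i m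
  proof -
    have "cf (t (i', m')) i (2 * i) m = (if (i', m') = (i, m) then cf \<chi> i (2 * i) m else 0)"
      if "(i', m') \<in> S" for i' m'
    proof (cases "m' \<le> m")
      case True
      \<comment> \<open>This coefficient has weight exactly \<open>3 i'\<close>, while the two
        powers differ only from weight \<open>3 i' + 1\<close> on. For \<open>m' < m\<close> it then
        vanishes because \<open>h3 a\<close> is free of \<open>\<epsilon>\<close>; for
        \<open>m' = m\<close> equality of weights forces \<open>i' = i\<close>.\<close>
      have "cf (h ^ i' - h3 a ^ i') i (2 * i) (m - m') = 0"
        using power_diff_wt[OF hw h3_wt, of a 1 i'] h(1) that im True
        by (intro wtD[of _ 3 "i' * 3 + 1"]) (auto simp: S_def)
      then have e: "cf (h ^ i') i (2 * i) (m - m') = cf (h3 a ^ i') i (2 * i) (m - m')" by simp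
      show ?thesis
      proof (cases "m' = m")
        case True
        then have "i' = i" using that im by (auto simp: S_def)
        then show ?thesis using True e by (simp add: t_def cf_sE_power_mult cf_h3_power(3))
      next
        case False
        then show ?thesis using True e by (auto simp add: t_def cf_sE_power_mult cf_h3_power(2))
      qed
    next
      case False
      then show ?thesis by (auto simp: t_def cf_sE_power_mult)
    qed
    then have "(\<Sum>s\<in>S. cf (t s) i (2 * i) m) = (\<Sum>s\<in>S. if s = (i, m) then cf \<chi> i (2 * i) m else 0)"
      by (intro sum.cong) (auto split: if_splits)
    also have "\<dots> = cf \<chi> i (2 * i) m"
      using fin im by (simp add: S_def)
    finally show ?thesis by (simp add: \<kappa>_def)
  qed
  show ?thesis by (rule that[OF 1 2 3 4])
qed

section \<open>Normal-form Hamiltonians as a weight and shape condition\<close>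

lemma normal_ham_shape:
  assumes "A_form A" "B_form B"
  shows "normal_ham a A B - h3 a \<in> W 4" "normal_shape (normal_ham a A B - h3 a)"
proof -
  have e: "normal_ham a A B - h3 a = A + sY * B" by (simp add: normal_ham_def h3_def)
  show "normal_ham a A B - h3 a \<in> W 4"
  proof (rule wtI)
    fix k l m :: nat assume w: "k + l + 3 * m < 4"
    have "cf A k l m = 0" using assms(1) w by (fastforce simp: A_form_def)
    \<comment> \<open>The lowest possible monomial of \<open>B\<close> is \<open>x y^2\<close>, so
      \<open>y B\<close> starts at weight four.\<close>
    moreover have "cf B k l' m = 0" if "l = Suc l'" for l'
    proof (rule ccontr)
      assume "cf B k l' m \<noteq> 0"
      then obtain q where "q \<ge> 1" "k = 2 * q - 1" "l' = 2 * (2 * q - 1)"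
        using assms(2) by (auto simp: B_form_def)
      then show False using w that by simp
    qed
    ultimately show "cf (normal_ham a A B - h3 a) k l m = 0"
      unfolding e by (simp add: cf_sY_mult split: nat.split)
  qed
  show "normal_shape (normal_ham a A B - h3 a)"
    unfolding normal_shape_def
  proof (intro allI impI)
    fix i j m assume n: "cf (normal_ham a A B - h3 a) i j m \<noteq> 0"
    show "odd i \<and> (j = 0 \<or> j = 2 * i + 1)"
    proof (cases "cf A i j m = 0")
      case True
      then obtain j' where j': "j = Suc j'" "cf B i j' m \<noteq> 0"
        using n unfolding e by (auto simp: cf_sY_mult split: nat.splits)
      then obtain q where "q \<ge> 1" "i = 2 * q - 1" "j' = 2 * (2 * q - 1)"
        using assms(2) by (auto simp: B_form_def)
      then show ?thesis using j' by simp
    next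
      case False
      then show ?thesis using assms(1) by (fastforce simp: A_form_def)
    qed
  qed
qed

text \<open>Converse of \<open>normal_ham_shape\<close>: \<open>A\<close> is the part of
  \<open>h - h3 a\<close> free of \<open>y\<close>, and \<open>B\<close> is the resonant part
  divided by \<open>y\<close>.\<close>

lemma normal_shape_ham:
  assumes "h - h3 a \<in> W 4" "normal_shape (h - h3 a)"
  obtains A B where "A_form A" "B_form B" "h = normal_ham a A B"
proof -
  define N where "N = h - h3 a"
  define A where "A = mk_series (\<lambda>i j m. if j = 0 then cf N i j m else 0)"
  define B where "B = mk_series (\<lambda>i j m. if j = 2 * i then cf N i (Suc j) m else 0)"
  have odd: "\<exists>k\<ge>1. i = 2 * k - 1" if "odd i" for i :: nat
    using that by (intro exI[of _ "Suc (i div 2)"]) simp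
  have sh: "odd i \<and> (j = 0 \<or> j = 2 * i + 1)" if "cf N i j m \<noteq> 0" for i j m
    using assms(2) that unfolding normal_shape_def N_def by blast
  have "A_form A"
    unfolding A_form_def
  proof (intro allI impI)
    fix i j m assume "cf A i j m \<noteq> 0"
    then have *: "j = 0" "cf N i j m \<noteq> 0" by (auto simp: A_def split: if_splits)
    moreover have "\<not> i + j + 3 * m < 4"
      using wtD[OF assms(1)[folded N_def], of i j m] *(2) by blast
    ultimately show "j = 0 \<and> (\<exists>k\<ge>1. i = 2 * k - 1 \<and> (2 * k - 1) + 3 * m \<ge> 4)"
      using odd[of i] sh[of i j m] by auto
  qed
  moreover have "B_form B"
    unfolding B_form_def
  proof (intro allI impI)
    fix i j m assume "cf B i j m \<noteq> 0"
    then have "j = 2 * i" "cf N i (Suc j) m \<noteq> 0" by (auto simp: B_def split: if_splits)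
    then show "\<exists>k\<ge>1. i = 2 * k - 1 \<and> j = 2 * (2 * k - 1)"
      using odd[of i] sh[of i "Suc j" m] by auto
  qed
  moreover have "N = A + sY * B"
  proof (rule series_eqI)
    show "cf N i j m = cf (A + sY * B) i j m" for i j m
      using sh[of i j m] by (cases j) (auto simp: A_def B_def cf_sY_mult)
  qed
  then have "h = normal_ham a A B" by (simp add: N_def normal_ham_def h3_def algebra_simps)
  ultimately show ?thesis using that by blast
qed

text \<open>\<open>a\<close> is the coefficient of \<open>x^3\<close>, where \<open>A\<close> has no
  term by its weight bound; \<open>A\<close> is free of \<open>y\<close> while \<open>y B\<close> is
  divisible by it.\<close>

lemma normal_ham_inject:
  assumes "A_form A" "B_form B" "A_form A'" "B_form B'" "normal_ham a A B = normal_ham a' A' B'"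
  shows "a = a' \<and> A = A' \<and> B = B'"
proof -
  have nf: "cf (normal_ham a A B) k l m =
    cf (h3 a) k l m + cf A k l m + (case l of 0 \<Rightarrow> 0 | Suc l' \<Rightarrow> cf B k l' m)" for a A B k l m
    by (simp add: normal_ham_def h3_def cf_sY_mult)
  have eq: "cf (h3 a) k l m + cf A k l m + (case l of 0 \<Rightarrow> 0 | Suc l' \<Rightarrow> cf B k l' m) =
    cf (h3 a') k l m + cf A' k l m + (case l of 0 \<Rightarrow> 0 | Suc l' \<Rightarrow> cf B' k l' m)" for k l m
    using assms(5) by (simp only: nf[symmetric])
  have "cf A 3 0 0 = 0" "cf A' 3 0 0 = 0"
    using assms(1,3) by (fastforce simp: A_form_def)+
  then have a: "a = a'" using eq[of 3 0 0] by (simp add: cf_h3)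
  have A0: "cf A k (Suc l) m = 0" "cf A' k (Suc l) m = 0" for k l m
    using assms(1,3) by (fastforce simp: A_form_def)+
  have "A = A'"
  proof (rule series_eqI)
    show "cf A k l m = cf A' k l m" for k l m
      using eq[of k l m] A0[of k _ m] a by (cases l) simp_all
  qed
  moreover have "B = B'"
  proof (rule series_eqI)
    show "cf B k l m = cf B' k l m" for k l m
      using eq[of k "Suc l" m] a A0 by simp
  qed
  ultimately show ?thesis using a by simp
qed

section \<open>Uniqueness\<close>

lemma shom_near_id:
  assumes T: "shom T" "T sX - sX \<in> W (Suc n)" "T sY - sY \<in> W (Suc n)" and f: "f \<in> W w"
  shows "T f - f \<in> W (w + n)"
proof -
  note S = shomD[OF T(1)] shom_simps[OF T(1)]
  have mon: "T (mon i j p) - mon i j p \<in> W (i + j + 3 * p + n)" for i j p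
  proof -
    have e: "T (mon i j p) - mon i j p =
      ((T sX ^ i - sX ^ i) * T sY ^ j + sX ^ i * (T sY ^ j - sY ^ j)) * sE ^ p"
      by (simp add: mon_def S algebra_simps)
    have x: "T sX ^ i - sX ^ i \<in> W (i + n)" and y: "T sY ^ j - sY ^ j \<in> W (j + n)"
      using power_diff_wt[OF shom_gen_wt(1)[OF T(1)] wt_gen(1), of n i]
        power_diff_wt[OF shom_gen_wt(2)[OF T(1)] wt_gen(2), of n j] T(2,3) by simp_all
    have "(T sX ^ i - sX ^ i) * T sY ^ j \<in> W (i + j + n)"
      by (rule wt_mult_le[OF x wt_power[OF shom_gen_wt(2)[OF T(1)]]]) simp
    moreover have "sX ^ i * (T sY ^ j - sY ^ j) \<in> W (i + j + n)"
      by (rule wt_mult_le[OF wt_power[OF wt_gen(1)] y]) simp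
    ultimately show ?thesis
      unfolding e by (intro wt_mult_le[OF wt_add wt_power[OF wt_gen(3)]]) auto
  qed
  define N where "N = w + n"
  have r: "f - trunc N f \<in> W (w + n)"
    by (rule trunc_wt) (simp_all add: N_def)
  have "T (trunc N f) - trunc N f =
    (\<Sum>i\<le>N. \<Sum>j\<le>N. \<Sum>p\<le>N. sconst (cf f i j p) * (T (mon i j p) - mon i j p))"
    by (simp add: trunc_def S sum_subtractf right_diff_distrib)
  also have "\<dots> \<in> W (w + n)"
  proof (intro wt_sum)
    fix i j p
    show "sconst (cf f i j p) * (T (mon i j p) - mon i j p) \<in> W (w + n)"
    proof (cases "i + j + 3 * p < w")
      case False
      then show ?thesis by (intro wt_sconst wt_mono[OF mon]) simp
    qed (simp add: wtD[OF f])
  qed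
  finally have "T (trunc N f) - trunc N f + T (f - trunc N f) - (f - trunc N f) \<in> W (w + n)"
    by (rule wt_diff[OF wt_add[OF _ S(5)[OF r]] r])
  then show ?thesis by (simp add: S)
qed

text \<open>To first order the exponential varies by \<open>lie (\<theta> - \<eta>) f\<close>; every
  later term contains a further Lie derivative and gains one more weight. The smallness assumption
  concerns the operator rather than \<open>\<theta> - \<eta>\<close>, which may contain pure powers
  of \<open>\<epsilon>\<close> of low weight.\<close>

lemma exp_lie_diff:
  assumes \<eta>: "\<eta> \<in> W 3" "\<theta> \<in> W 3" and d: "d > 0"
    and X: "\<And>g v. g \<in> W v \<Longrightarrow> lie (\<theta> - \<eta>) g \<in> W (v + d)" and f: "f \<in> W w"
  shows "exp_lie \<theta> f - exp_lie \<eta> f - lie (\<theta> - \<eta>) f \<in> W (w + d + 1)"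
proof -
  have lie: "lie \<theta> g = lie \<eta> g + lie (\<theta> - \<eta>) g" for g
    by (simp add: lie_def poisson_simps)
  have D: "(lie \<theta> ^^ Suc k) f - (lie \<eta> ^^ Suc k) f \<in> W (w + k + d)" for k
  proof (induction k)
    case 0
    then show ?case using X[OF f] by (simp add: lie)
  next
    case (Suc k)
    have "(lie \<theta> ^^ Suc (Suc k)) f - (lie \<eta> ^^ Suc (Suc k)) f =
      lie \<theta> ((lie \<theta> ^^ Suc k) f - (lie \<eta> ^^ Suc k) f) + lie (\<theta> - \<eta>) ((lie \<eta> ^^ Suc k) f)"
      by (simp add: lie)
    moreover have "lie \<theta> ((lie \<theta> ^^ Suc k) f - (lie \<eta> ^^ Suc k) f) \<in> W (w + Suc k + d)"
      using lie_wt_Suc[OF \<eta>(2) Suc] by simp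
    moreover have "lie (\<theta> - \<eta>) ((lie \<eta> ^^ Suc k) f) \<in> W (w + Suc k + d)"
      by (rule X[OF lie_pow_wt[OF \<eta>(1) f]])
    ultimately show ?case by (simp only: wt_add)
  qed
  define u where "u = (\<lambda>k. lterm \<theta> k f - lterm \<eta> k f)"
  have u: "u (Suc k) \<in> W (w + k + d)" for k
    using wt_sconst[OF D[of k], of "1 / fact (Suc k)"]
    by (simp add: u_def lterm_def right_diff_distrib)
  \<comment> \<open>Keeping \<open>d + 1\<close> terms puts both remainders into weight
    \<open>w + d + 1\<close>.\<close>
  obtain d' where d': "d = Suc d'" using d by (cases d) auto
  have "(\<Sum>k<Suc (Suc d'). u k) = u 0 + u 1 + (\<Sum>k<d'. u (Suc (Suc k)))"
    by (simp only: sum.lessThan_Suc_shift) (simp add: add.assoc)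
  moreover have "u 0 = 0" "u 1 = lie (\<theta> - \<eta>) f"
    by (simp_all add: u_def lterm_1 lie)
  ultimately have s: "(\<Sum>k<Suc (Suc d'). lterm \<theta> k f) - (\<Sum>k<Suc (Suc d'). lterm \<eta> k f) - lie (\<theta> - \<eta>) f
     = (\<Sum>k<d'. u (Suc (Suc k)))"
    by (simp add: u_def sum_subtractf)
  have a: "(\<Sum>k<d'. u (Suc (Suc k))) \<in> W (w + d + 1)"
    by (intro wt_sum wt_mono[OF u]) simp
  have b: "exp_lie \<theta> f - (\<Sum>k<Suc (Suc d'). lterm \<theta> k f) \<in> W (w + d + 1)"
    "exp_lie \<eta> f - (\<Sum>k<Suc (Suc d'). lterm \<eta> k f) \<in> W (w + d + 1)"
    using exp_lie_approx[OF \<eta>(2) f, of "Suc (Suc d')"] exp_lie_approx[OF \<eta>(1) f, of "Suc (Suc d')"]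
    by (simp_all add: d')
  have "(exp_lie \<theta> f - (\<Sum>k<Suc (Suc d'). lterm \<theta> k f)) -
    (exp_lie \<eta> f - (\<Sum>k<Suc (Suc d'). lterm \<eta> k f)) + (\<Sum>k<d'. u (Suc (Suc k))) \<in> W (w + d + 1)"
    by (rule wt_add[OF wt_diff[OF b] a])
  then show ?thesis unfolding s[symmetric] by (simp add: algebra_simps)
qed

lemma exp_lie_1: "\<eta> \<in> W 3 \<Longrightarrow> f \<in> W w \<Longrightarrow> exp_lie \<eta> f - f \<in> W (Suc w)"
  using exp_lie_approx[of \<eta> f w 1] by simp

lemma exp_lie_2:
  assumes "\<eta> \<in> W (d + 2)" "d > 0" "f \<in> W w"
  shows "exp_lie \<eta> f - f - lie \<eta> f \<in> W (w + d + 1)"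
proof -
  have \<eta>: "\<eta> \<in> W 3" using assms(1,2) by (auto intro: wt_mono)
  have "exp_lie 0 f = f" by (rule exp_lie_fixed) (auto simp: lie_def poisson_simps)
  then show ?thesis
    using exp_lie_diff[OF wt_0 \<eta> assms(2) _ assms(3)] lie_wt[of \<eta> d] assms(1) by simp
qed

text \<open>Induction on the weight of the gradient of \<open>\<delta> = a - b\<close>: if
  \<open>lie \<delta>\<close> gains \<open>d + 1\<close>, the difference of the squares is
  \<open>2 * lie \<delta>\<close> up to terms gaining \<open>d + 2\<close>, so
  \<open>lie \<delta>\<close> itself gains \<open>d + 2\<close>. Only the gradient is determined, as
  pure powers of \<open>\<epsilon>\<close> do not act.\<close>

lemma exp_lie_square_inject:
  assumes ab: "a \<in> W 3" "b \<in> W 3" and eq: "\<And>f. exp_lie a (exp_lie a f) = exp_lie b (exp_lie b f)"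
  shows "pd_x (a - b) = 0" "pd_y (a - b) = 0"
proof -
  define \<delta> where "\<delta> = a - b"
  have *: "pd_x \<delta> \<in> W (d + 2) \<and> pd_y \<delta> \<in> W (d + 2)" for d
  proof (induction d)
    case 0
    then show ?case using wt_pd[OF wt_diff[OF ab]] by (simp add: \<delta>_def numeral_2_eq_2)
  next
    case (Suc d)
    have L: "lie \<delta> g \<in> W (v + Suc d)" if "g \<in> W v" for g v
    proof -
      have le: "v + Suc d \<le> (v - 1) + (d + 2)" by linarith
      have "pd_x g * pd_y \<delta> \<in> W (v + Suc d)" "pd_y g * pd_x \<delta> \<in> W (v + Suc d)"
        using wt_mult_le[OF wt_pd(1)[OF that] _ le] wt_mult_le[OF wt_pd(2)[OF that] _ le] Suc by blast+
      then show ?thesis unfolding lie_def poisson_def by (rule wt_diff)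
    qed
    have main: "lie \<delta> f \<in> W (w + d + 2)" if f: "f \<in> W w" for f w
    proof -
      define R where "R = (\<lambda>f. exp_lie a f - exp_lie b f - lie \<delta> f)"
      have R: "R f \<in> W (w + d + 2)" if "f \<in> W w" for f
        using exp_lie_diff[OF ab(2,1) zero_less_Suc, of d f w] L that by (simp add: R_def \<delta>_def)
      have e: "exp_lie a g = exp_lie b g + lie \<delta> g + R g" for g by (simp add: R_def)
      have "0 = exp_lie a (exp_lie a f) - exp_lie a (exp_lie b f) +
          (exp_lie a (exp_lie b f) - exp_lie b (exp_lie b f))"
        by (simp add: eq)
      also have "exp_lie a (exp_lie a f) - exp_lie a (exp_lie b f) = exp_lie a (lie \<delta> f) + exp_lie a (R f)"
        by (subst (2) e) (simp add: exp_lie_add[OF ab(1)])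
      also have "exp_lie a (exp_lie b f) - exp_lie b (exp_lie b f) = lie \<delta> (exp_lie b f) + R (exp_lie b f)"
        by (subst e) simp
      finally have 0: "sconst 2 * lie \<delta> f = - ((exp_lie a (lie \<delta> f) - lie \<delta> f) + exp_lie a (R f) +
        lie \<delta> (exp_lie b f - f) + R (exp_lie b f))"
        using sconst_simps(4)[of 1 1] by (simp add: algebra_simps)
      have "sconst 2 * lie \<delta> f \<in> W (w + d + 2)"
        unfolding 0
        using exp_lie_1[OF ab(1) L[OF f]] exp_lie_wt[OF ab(1) R[OF f]] L[OF exp_lie_1[OF ab(2) f]]
          R[OF exp_lie_wt[OF ab(2) f]]
        by (intro wt_uminus wt_add) simp_all
      then show ?thesis by (simp add: wt_def)
    qed
    show ?case
      \<comment> \<open>On the coordinates, \<open>lie \<delta>\<close> returns the partial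
        derivatives of \<open>\<delta>\<close> up to sign.\<close>
      using main[OF wt_gen(1)] main[OF wt_gen(2)] wt_uminus[of "- pd_x \<delta>"]
      by (simp add: lie_def poisson_def)
  qed
  have "pd_x \<delta> \<in> W n" "pd_y \<delta> \<in> W n" for n
    using *[of n] by (auto intro: wt_mono)
  then show "pd_x (a - b) = 0" "pd_y (a - b) = 0"
    unfolding \<delta>_def by (blast intro: wt_eq_0)+
qed

section \<open>Canonical changes commuting with \<open>D\<close> and close to the identity\<close>

definition near_id :: "nat \<Rightarrow> (series \<Rightarrow> series) \<Rightarrow> bool" where
  "near_id n T \<longleftrightarrow> shom T \<and> poisson (T sX) (T sY) = 1 \<and>
     (\<forall>f. pull Dmap (T f) = T (pull Dmap f)) \<and> T sX - sX \<in> W n \<and> T sY - sY \<in> W n"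

text \<open>Since the Jacobian is 1, the divergence of the displacement
  \<open>(\<xi>, \<zeta>)\<close> is minus the bracket of its components, of weight at least
  \<open>2 n - 2 \<ge> n\<close>. So the displacement is Hamiltonian to leading order; commutation
  with \<open>D\<close> makes \<open>\<xi>\<close> odd and \<open>\<zeta>\<close> even in
  \<open>x\<close>, hence \<open>\<chi>\<close> odd.\<close>

lemma near_id_hamiltonian:
  assumes T: "near_id n T" and n: "n \<ge> 2"
  obtains \<chi> where "odd_in_x \<chi>" "\<chi> \<in> W (Suc n)"
    "T sX - sX - pd_y \<chi> \<in> W (Suc n)" "T sY - sY + pd_x \<chi> \<in> W (Suc n)"
proof -
  define \<xi> \<zeta> where "\<xi> = T sX - sX" and "\<zeta> = T sY - sY"
  have wt: "\<xi> \<in> W n" "\<zeta> \<in> W n" and shom: "shom T"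
    using T by (auto simp: near_id_def \<xi>_def \<zeta>_def)
  note S = shom_simps[OF shom] shom_simps[OF Dmap_shom] Dmap
  have "pull Dmap \<xi> = - \<xi>" "pull Dmap \<zeta> = \<zeta>"
    using T by (simp_all add: near_id_def \<xi>_def \<zeta>_def S)
  then have D: "cf (pull Dmap \<xi>) k l m = - cf \<xi> k l m" "cf (pull Dmap \<zeta>) k l m = cf \<zeta> k l m" for k l m
    by simp_all
  have par: "even k \<Longrightarrow> cf \<xi> k l m = 0" "odd k \<Longrightarrow> cf \<zeta> k l m = 0" for k l m
    using D[of k l m] unfolding cf_Dmap by simp_all
  have "poisson (\<xi> + sX) (\<zeta> + sY) = 1"
    using T by (simp add: near_id_def \<xi>_def \<zeta>_def)
  then have "pd_x \<xi> + pd_y \<zeta> = - poisson \<xi> \<zeta>"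
    by (simp add: poisson_def algebra_simps eq_neg_iff_add_eq_0)
  moreover have "poisson \<xi> \<zeta> \<in> W n" using n by (intro poisson_wt[OF wt]) simp
  ultimately have "pd_x \<xi> + pd_y \<zeta> \<in> W n" by auto
  then have div: "(real k + 1) * cf \<xi> (Suc k) l m = - (real l + 1) * cf \<zeta> k (Suc l) m"
    if "k + l + 3 * m < n" for k l m
    using wtD[of "pd_x \<xi> + pd_y \<zeta>" 3 n k l m] that by (simp add: algebra_simps)
  \<comment> \<open>\<open>\<chi>\<close> integrates \<open>\<xi>\<close> in \<open>y\<close>; its
    part free of \<open>y\<close> integrates \<open>- \<zeta>\<close> at \<open>y = 0\<close> in
    \<open>x\<close>, with integration constant 0.\<close>
  define \<chi> where "\<chi> = mk_series (\<lambda>k l m. case l of Suc l' \<Rightarrow> cf \<xi> k l' m / real l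
    | 0 \<Rightarrow> (case k of Suc k' \<Rightarrow> - cf \<zeta> k' 0 m / real k | 0 \<Rightarrow> 0))"
  have "odd_in_x \<chi>"
    by (auto simp: odd_in_x_cf \<chi>_def par split: nat.split)
  moreover have "\<chi> \<in> W (Suc n)"
    by (rule wtI) (auto simp: \<chi>_def wtD[OF wt(1)] wtD[OF wt(2)] split: nat.split)
  moreover have "pd_y \<chi> = \<xi>"
    by (rule series_eqI) (simp add: \<chi>_def)
  moreover have "\<zeta> + pd_x \<chi> \<in> W (Suc n)"
  proof (rule wtI)
    fix k l m assume klm: "k + l + 3 * m < Suc n"
    show "cf (\<zeta> + pd_x \<chi>) k l m = 0"
    proof (cases l)
      case (Suc l')
      then show ?thesis using div[of k l' m] klm by (simp add: \<chi>_def field_simps)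
    qed (simp add: \<chi>_def)
  qed
  ultimately show ?thesis using that by (simp add: \<xi>_def \<zeta>_def)
qed

text \<open>The inverse flow of \<open>\<chi>\<close> cancels the displacement to first order, and
  oddness of \<open>\<chi>\<close> preserves commutation with \<open>D\<close>.\<close>

lemma near_id_correct:
  assumes T: "near_id n T" and n: "n \<ge> 2" and \<chi>: "odd_in_x \<chi>" "\<chi> \<in> W (Suc n)"
    and d: "T sX - sX - pd_y \<chi> \<in> W (Suc n)" "T sY - sY + pd_x \<chi> \<in> W (Suc n)"
  shows "near_id (Suc n) (\<lambda>f. exp_lie (- \<chi>) (T f))"
proof -
  have \<chi>3: "- \<chi> \<in> W 3" using n by (intro wt_uminus wt_mono[OF \<chi>(2)]) simp
  have T': "shom T" "poisson (T sX) (T sY) = 1" "pull Dmap (T f) = T (pull Dmap f)"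
    "T sX - sX \<in> W n" "T sY - sY \<in> W n" for f
    using T by (auto simp: near_id_def)
  note E = exp_lie_shom[OF \<chi>3]
  have near: "exp_lie (- \<chi>) (T g) - g \<in> W (Suc n)"
    if g: "g \<in> W 1" "T g - g \<in> W n" "T g - g - lie \<chi> g \<in> W (Suc n)" for g
  proof -
    have "exp_lie (- \<chi>) (T g) - g = (exp_lie (- \<chi>) g - g - lie (- \<chi>) g) +
      (exp_lie (- \<chi>) (T g - g) - (T g - g)) + (T g - g - lie \<chi> g)"
      by (simp add: shom_simps[OF E] lie_def poisson_simps)
    moreover have "exp_lie (- \<chi>) g - g - lie (- \<chi>) g \<in> W (Suc n)"
      using exp_lie_2[of "- \<chi>" "n - 1" g 1] \<chi>(2) n g(1) by (simp add: Suc_diff_le wt_uminus)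
    moreover have "exp_lie (- \<chi>) (T g - g) - (T g - g) \<in> W (Suc n)"
      by (rule exp_lie_1[OF \<chi>3 g(2)])
    ultimately show ?thesis using g(3) by (simp only: wt_add)
  qed
  have "exp_lie (- \<chi>) (T sX) - sX \<in> W (Suc n)" "exp_lie (- \<chi>) (T sY) - sY \<in> W (Suc n)"
    by (rule near; use T'(4,5) d wt_gen in \<open>simp add: lie_def poisson_def\<close>)+
  moreover have "poisson (exp_lie (- \<chi>) (T sX)) (exp_lie (- \<chi>) (T sY)) = 1"
    by (simp add: exp_lie_poisson[OF \<chi>3] T' shom_simps[OF E])
  moreover have "pull Dmap (exp_lie (- \<chi>) (T f)) = exp_lie (- \<chi>) (T (pull Dmap f))" for f
    using Dmap_exp_lie[OF \<chi>3, of "T f"] \<chi>(1) by (simp add: T' odd_in_x_simps)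
  ultimately show ?thesis
    by (simp add: near_id_def shom_compose[OF E T'(1)])
qed

text \<open>\<open>h - h'\<close> and the leading Hamiltonian of \<open>T\<close> satisfy a
  homological equation modulo weight \<open>n + 3\<close>; \<open>homological_unique\<close> applies
  to it once the kernel part is removed.\<close>

lemma near_id_step:
  assumes T: "near_id n T" "T h' = h" and n: "n \<ge> 2"
    and h: "h - h3 a \<in> W 4" "normal_shape (h - h3 a)"
    and h': "h' - h3 a' \<in> W 4" "normal_shape (h' - h3 a')"
  shows "h - h' \<in> W (n + 3)" "\<exists>T'. near_id (Suc n) T' \<and> T' h' = h"
proof -
  have hw: "h \<in> W 3" "h' \<in> W 3"
    using wt_add[OF wt_mono[OF h(1), of 3] h3_wt[of a]] wt_add[OF wt_mono[OF h'(1), of 3] h3_wt[of a']]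
    by simp_all
  have shom: "shom T" using T by (simp add: near_id_def)
  have "h - h' \<in> W (3 + (n - 1))"
    using shom_near_id[OF shom _ _ hw(2), of "n - 1"] T n by (simp add: near_id_def)
  then have h4: "h - h' \<in> W 4" by (rule wt_mono) (use n in simp)
  \<comment> \<open>\<open>h\<close> and \<open>h'\<close> agree below weight four, so their
    coefficients of \<open>x^3\<close> coincide.\<close>
  have "cf ((h - h') - (h - h3 a) + (h' - h3 a')) 3 0 0 = 0"
    by (rule wtD[OF wt_add[OF wt_diff[OF h4 h(1)] h'(1)]]) simp
  then have aa: "a' = a" by (simp add: cf_h3)
  have h_odd: "odd_in_x h"
    using h(2) h3_odd[of a] unfolding odd_in_x_cf normal_shape_def
    by (metis cf_diff diff_0_right)
  define N where "N = h - h'"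
  have N: "normal_shape N"
    using h(2) h'(2) unfolding normal_shape_def N_def aa
    by (metis (no_types, lifting) cf_diff diff_diff_eq2 diff_add_cancel diff_self right_minus_eq)
  obtain \<chi> where \<chi>: "odd_in_x \<chi>" "\<chi> \<in> W (Suc n)"
    "T sX - sX - pd_y \<chi> \<in> W (Suc n)" "T sY - sY + pd_x \<chi> \<in> W (Suc n)"
    by (rule near_id_hamiltonian[OF T(1) n])
  have \<chi>3: "\<chi> \<in> W 3" using n by (intro wt_mono[OF \<chi>(2)]) simp
  \<comment> \<open>\<open>S\<close> serves to derive the homological equation; it takes
    \<open>h'\<close> to \<open>exp_lie (- \<chi>) h\<close>.\<close>
  define S where "S = (\<lambda>f. exp_lie (- \<chi>) (T f))"
  have S: "near_id (Suc n) S"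
    unfolding S_def by (rule near_id_correct[OF T(1) n \<chi>])
  have "S h' - h' \<in> W (3 + n)"
    using S by (intro shom_near_id hw) (auto simp: near_id_def)
  then have 1: "exp_lie \<chi> (S h' - h') \<in> W (n + 3)"
    using exp_lie_wt[OF \<chi>3] by (simp add: add.commute)
  have "exp_lie \<chi> (S h') = h"
    using exp_lie_inverse[of "- \<chi>" h] \<chi>3 T(2) by (auto simp: S_def)
  then have "N = exp_lie \<chi> (S h' - h') + (exp_lie \<chi> h' - h')"
    by (simp add: N_def shom_simps[OF exp_lie_shom[OF \<chi>3]])
  moreover have 2: "exp_lie \<chi> h' - h' - lie \<chi> h' \<in> W (n + 3)"
    using exp_lie_2[of \<chi> "n - 1" h' 3] \<chi>(2) n hw(2) by (simp add: numeral_3_eq_3)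
  have L: "lie \<psi> (g - h3 a) \<in> W (n + 3)" if "\<psi> \<in> W (Suc n)" "g - h3 a \<in> W 4" for \<psi> g
    unfolding lie_def by (rule poisson_wt[OF that(2,1)]) simp
  ultimately have eN: "N - lie \<chi> (h3 a) = exp_lie \<chi> (S h' - h') + (exp_lie \<chi> h' - h' - lie \<chi> h')
     + lie \<chi> (h' - h3 a)"
    by simp
  have eq: "N - lie \<chi> (h3 a) \<in> W (n + 3)"
    unfolding eN by (intro wt_add 1 2 L \<chi> h'(1)[unfolded aa])
  \<comment> \<open>\<open>\<kappa>\<close> carries the resonant coefficients of
    \<open>\<chi>\<close>; as \<open>lie \<kappa> h = 0\<close>, subtracting it changes the equation
    only by \<open>lie \<kappa> (h - h3 a)\<close>.\<close>
  obtain \<kappa> where \<kappa>: "odd_in_x \<kappa>" "\<kappa> \<in> W (Suc n)" "lie \<kappa> h = 0"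
    "\<And>i m. odd i \<Longrightarrow> 3 * i + 3 * m = Suc n \<Longrightarrow> cf \<kappa> i (2 * i) m = cf \<chi> i (2 * i) m"
    by (rule kernel_element[OF h(1) h_odd \<chi>(2)]) (rule that)
  have "N - lie (\<chi> - \<kappa>) (h3 a) = (N - lie \<chi> (h3 a)) - lie \<kappa> (h - h3 a)"
    using \<kappa>(3) by (simp add: lie_def poisson_simps)
  also have "\<dots> \<in> W (n + 3)"
    by (intro wt_diff eq L \<kappa> h)
  finally have "N - lie (\<chi> - \<kappa>) (h3 a) \<in> W (Suc n + 2)"
    by (simp add: numeral_eq_Suc)
  note hu = homological_unique[OF _ _ N this]
  have c: "\<chi> - \<kappa> \<in> W (Suc (Suc n))" and NW: "N \<in> W (Suc n + 2)"
    by (rule hu; use \<chi> \<kappa> in \<open>auto simp: odd_in_x_simps\<close>)+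
  show "h - h' \<in> W (n + 3)" using NW by (simp add: N_def numeral_eq_Suc)
  \<comment> \<open>\<open>\<chi> - \<kappa>\<close> has weight at least \<open>n + 2\<close>, so
    \<open>\<kappa>\<close> can replace \<open>\<chi>\<close> as leading Hamiltonian, and its flow
    fixes \<open>h\<close> exactly.\<close>
  have "T sX - sX - pd_y \<kappa> = (T sX - sX - pd_y \<chi>) + pd_y (\<chi> - \<kappa>)"
    "T sY - sY + pd_x \<kappa> = (T sY - sY + pd_x \<chi>) - pd_x (\<chi> - \<kappa>)"
    by simp_all
  then have "T sX - sX - pd_y \<kappa> \<in> W (Suc n)" "T sY - sY + pd_x \<kappa> \<in> W (Suc n)"
    using \<chi>(3,4) wt_pd[OF c] by (auto simp only: diff_Suc_1 intro: wt_add wt_diff)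
  then have "near_id (Suc n) (\<lambda>f. exp_lie (- \<kappa>) (T f))"
    by (rule near_id_correct[OF T(1) n \<kappa>(1,2)])
  moreover have "exp_lie (- \<kappa>) (T h') = h"
    unfolding T(2) using n \<kappa>(3)
    by (intro exp_lie_fixed wt_uminus wt_mono[OF \<kappa>(2)]) (simp_all add: lie_def poisson_simps)
  ultimately show "\<exists>T'. near_id (Suc n) T' \<and> T' h' = h" by blast
qed

text \<open>Commutation with \<open>D\<close> makes the linear part diagonal,
  \<open>(\<alpha> x, \<delta> y)\<close>. The Jacobian gives \<open>\<alpha> \<delta> = 1\<close>,
  and the coefficient of \<open>x y^2\<close>, equal to one in both Hamiltonians, gives
  \<open>\<alpha> \<delta>^2 = 1\<close>; hence both are one.\<close>

lemma near_id_2: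
  assumes T: "shom T" "poisson (T sX) (T sY) = 1" "\<And>f. pull Dmap (T f) = T (pull Dmap f)"
    and Th: "T h' = h" and h: "h - h3 a \<in> W 4" and h': "h' - h3 a' \<in> W 4"
  shows "near_id 2 T"
proof -
  note S = shomD[OF T(1)] shom_simps[OF T(1)]
  define u v where "u = T sX" and "v = T sY"
  have uv: "u \<in> W 1" "v \<in> W 1" using shom_gen_wt[OF T(1)] by (auto simp: u_def v_def)
  have "pull Dmap u = - u" "pull Dmap v = v"
    using T(3) by (simp_all add: u_def v_def Dmap S)
  then have "cf u 0 1 0 = - ((- 1) ^ 0 * cf u 0 1 0)" "cf v 1 0 0 = (- 1) ^ 1 * cf v 1 0 0"
    unfolding cf_Dmap[symmetric] by simp_all
  then have uv0: "cf u 0 1 0 = 0" "cf v 1 0 0 = 0" by simp_all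
  define \<alpha> \<delta> where "\<alpha> = cf u 1 0 0" and "\<delta> = cf v 0 1 0"
  have u1: "u - sconst \<alpha> * sX \<in> W 2" and v1: "v - sconst \<delta> * sY \<in> W 2"
    using uv uv0 by (auto intro!: wtI simp: cf_gen \<alpha>_def \<delta>_def wt_def less_2_cases_iff add_is_1)
  have "cf (poisson u v) 0 0 0 = 1" using T(2) by (simp add: u_def v_def cf_1)
  then have 1: "\<alpha> * \<delta> = 1"
    by (simp add: poisson_def cf_mult uv0[simplified] \<alpha>_def \<delta>_def)
  have sw: "sconst \<alpha> * sX \<in> W 1" "sconst \<delta> * sY \<in> W 1" using wt_gen by auto
  have "u - sconst \<alpha> * sX \<in> W (1 + 1)" "v - sconst \<delta> * sY \<in> W (1 + 1)"
    using u1 v1 by (simp_all only: one_add_one)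
  note p' = power_diff_wt[OF uv(1) sw(1) this(1)] power_diff_wt[OF uv(2) sw(2) this(2)]
  have p: "v ^ 2 - (sconst \<delta> * sY) ^ 2 \<in> W 3" "u ^ 3 - (sconst \<alpha> * sX) ^ 3 \<in> W 4"
    by (rule wt_mono[OF p'(2)], simp) (rule wt_mono[OF p'(1)], simp)
  have "(u - sconst \<alpha> * sX) * v ^ 2 \<in> W 4"
    by (rule wt_mult_le[OF u1 wt_power[OF uv(2)]]) simp
  moreover have "sconst \<alpha> * sX * (v ^ 2 - (sconst \<delta> * sY) ^ 2) \<in> W 4"
    by (rule wt_mult_le[OF sw(1) p(1)]) simp
  moreover have "T (h' - h3 a') \<in> W 4" using S(5) h' .
  moreover note h p
  ultimately have "((h - h3 a) - T (h' - h3 a')) - ((u - sconst \<alpha> * sX) * v ^ 2 +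
     sconst \<alpha> * sX * (v ^ 2 - (sconst \<delta> * sY) ^ 2) + sconst a' * (u ^ 3 - (sconst \<alpha> * sX) ^ 3)) \<in> W 4"
    by (meson wt_diff wt_add wt_sconst)
  also have "((h - h3 a) - T (h' - h3 a')) - ((u - sconst \<alpha> * sX) * v ^ 2 +
     sconst \<alpha> * sX * (v ^ 2 - (sconst \<delta> * sY) ^ 2) + sconst a' * (u ^ 3 - (sconst \<alpha> * sX) ^ 3)) =
     sconst \<alpha> * (sconst \<delta> * (sconst \<delta> * (sX * sY ^ 2))) +
     sconst a' * (sconst \<alpha> * (sconst \<alpha> * (sconst \<alpha> * sX ^ 3))) - h3 a"
    by (simp add: S Th h3_def u_def[symmetric] v_def[symmetric] power2_eq_square power3_eq_cube algebra_simps)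
  finally have "cf (sconst \<alpha> * (sconst \<delta> * (sconst \<delta> * (sX * sY ^ 2))) +
     sconst a' * (sconst \<alpha> * (sconst \<alpha> * (sconst \<alpha> * sX ^ 3))) - h3 a) 1 2 0 = 0"
    by (rule wtD) simp
  then have "\<alpha> * \<delta> * \<delta> = 1"
    using cf_mon[of 1 2 0 1 2 0] cf_mon[of 3 0 0 1 2 0] by (simp add: cf_h3 mon_def)
  then have "\<delta> = 1" "\<alpha> = 1" using 1 by auto
  then have "T sX - sX \<in> W 2" "T sY - sY \<in> W 2"
    using u1 v1 by (simp_all add: u_def v_def)
  then show ?thesis using T by (simp add: near_id_def)
qed

text \<open>\<open>near_id_step\<close> yields a new \<open>T\<close> for every \<open>n\<close>
  while \<open>h\<close> and \<open>h'\<close> stay fixed, so \<open>h - h'\<close> has arbitrarily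
  high weight.\<close>

lemma normal_form_unique:
  assumes T: "shom T" "poisson (T sX) (T sY) = 1" "\<And>f. pull Dmap (T f) = T (pull Dmap f)"
    and Th: "T h' = h" and h: "h - h3 a \<in> W 4" "normal_shape (h - h3 a)"
    and h': "h' - h3 a' \<in> W 4" "normal_shape (h' - h3 a')"
  shows "h = h'"
proof -
  have ex: "\<exists>T. near_id (n + 2) T \<and> T h' = h" for n
  proof (induction n)
    case 0
    then show ?case using near_id_2[OF T Th h(1) h'(1)] Th unfolding add_0 by blast
  next
    case (Suc n)
    then show ?case using near_id_step(2)[OF _ _ _ h h', of "n + 2"] by auto
  qed
  have "h - h' \<in> W n" for n
  proof -
    obtain T where "near_id (n + 2) T" "T h' = h" using ex by blast
    then have "h - h' \<in> W (n + 2 + 3)" by (rule near_id_step(1)[OF _ _ _ h h']) simp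
    then show ?thesis by (rule wt_mono) simp
  qed
  then have "h - h' = 0" by (rule wt_eq_0)
  then show ?thesis by simp
qed

section \<open>Conjugacy of maps\<close>

lemma is_inverseD:
  assumes "is_inverse \<eta> \<phi>" "fixes_origin \<phi>"
  shows "fixes_origin \<eta>" "pull \<eta> (pull \<phi> f) = f" "pull \<phi> (pull \<eta> f) = f"
proof -
  show \<eta>: "fixes_origin \<eta>" using assms(1) by (simp add: is_inverse_def)
  show "pull \<eta> (pull \<phi> f) = f" "pull \<phi> (pull \<eta> f) = f"
    using pull_fcomp(2)[OF \<eta> assms(2), of f] pull_fcomp(2)[OF assms(2) \<eta>, of f] assms(1)
    by (simp_all add: is_inverse_def fid)
qed

lemma is_inverseI:
  assumes "fixes_origin \<eta>" "fixes_origin \<phi>"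
    "\<And>f. pull \<eta> (pull \<phi> f) = f" "\<And>f. pull \<phi> (pull \<eta> f) = f"
  shows "is_inverse \<eta> \<phi>"
  unfolding is_inverse_def
  by (intro conjI assms pull_inject pull_fcomp fid) (simp_all add: pull_fcomp assms fid)

lemma pull_Dmap_time_one:
  assumes "h \<in> W 3"
  shows "fixes_origin (Dmap \<circ>\<^sub>f time_one h)"
    "pull (Dmap \<circ>\<^sub>f time_one h) f = exp_lie h (pull Dmap f)"
  using pull_fcomp[OF Dmap(1) time_one(1)[OF assms]] by (simp_all add: time_one(2)[OF assms])

lemma pull_conjugate:
  assumes "fixes_origin \<eta>" "fixes_origin G" "fixes_origin \<phi>"
  shows "fixes_origin (\<eta> \<circ>\<^sub>f G \<circ>\<^sub>f \<phi>)" "pull (\<eta> \<circ>\<^sub>f G \<circ>\<^sub>f \<phi>) f = pull \<phi> (pull G (pull \<eta> f))"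
  using assms by (simp_all add: pull_fcomp)

lemma canonical_fixes: "canonical \<phi> \<Longrightarrow> fixes_origin \<phi>"
  by (simp add: canonical_def)

lemma canonical_fcomp:
  assumes "canonical \<theta>" "canonical \<psi>"
  shows "canonical (\<theta> \<circ>\<^sub>f \<psi>)"
proof (rule canonicalI)
  note f = canonical_fixes[OF assms(1)] canonical_fixes[OF assms(2)]
  show "fixes_origin (\<theta> \<circ>\<^sub>f \<psi>)" by (rule pull_fcomp[OF f])
  have "poisson sX sY = 1" by (simp add: poisson_def)
  then show "poisson (pull (\<theta> \<circ>\<^sub>f \<psi>) sX) (pull (\<theta> \<circ>\<^sub>f \<psi>) sY) = 1"
    by (simp add: pull_fcomp f canonical_poisson assms shom_simps pull_shom)
qed

lemma conjugates_trans:
  assumes c: "conjugates \<psi> F G" "conjugates \<theta> G H" and f: "fixes_origin \<psi>" "fixes_origin \<theta>" "fixes_origin H"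
  shows "conjugates (\<theta> \<circ>\<^sub>f \<psi>) F H"
proof -
  obtain \<eta> \<zeta> where \<eta>: "is_inverse \<eta> \<psi>" "F = \<eta> \<circ>\<^sub>f G \<circ>\<^sub>f \<psi>" and \<zeta>: "is_inverse \<zeta> \<theta>" "G = \<zeta> \<circ>\<^sub>f H \<circ>\<^sub>f \<theta>"
    using c by (auto simp: conjugates_def)
  note i = is_inverseD[OF \<eta>(1) f(1)] is_inverseD[OF \<zeta>(1) f(2)]
  have G: "fixes_origin G" unfolding \<zeta>(2) by (rule pull_conjugate(1)[OF i(4) f(3,2)])
  have "is_inverse (\<eta> \<circ>\<^sub>f \<zeta>) (\<theta> \<circ>\<^sub>f \<psi>)"
    by (rule is_inverseI) (simp_all add: pull_fcomp i f)
  moreover have "F = (\<eta> \<circ>\<^sub>f \<zeta>) \<circ>\<^sub>f H \<circ>\<^sub>f (\<theta> \<circ>\<^sub>f \<psi>)"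
  proof (rule pull_inject)
    show "fixes_origin F" "fixes_origin (\<eta> \<circ>\<^sub>f \<zeta> \<circ>\<^sub>f H \<circ>\<^sub>f (\<theta> \<circ>\<^sub>f \<psi>))"
      unfolding \<eta>(2) by (intro pull_conjugate pull_fcomp i f G)+
    show "pull F u = pull (\<eta> \<circ>\<^sub>f \<zeta> \<circ>\<^sub>f H \<circ>\<^sub>f (\<theta> \<circ>\<^sub>f \<psi>)) u" for u
      unfolding \<eta>(2) using G by (simp add: pull_fcomp i f \<zeta>(2))
  qed
  ultimately show ?thesis unfolding conjugates_def by blast
qed

text \<open>A canonical \<open>\<theta>\<close> intertwines the Lie derivatives of \<open>h\<close>
  and of its pullback \<open>g\<close>, hence their exponentials; commutation with \<open>D\<close>
  does the rest.\<close>

lemma conjugates_time_one: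
  assumes \<theta>: "canonical \<theta>" "is_inverse \<zeta> \<theta>" and D: "\<And>f. pull \<theta> (pull Dmap f) = pull Dmap (pull \<theta> f)"
    and gh: "g \<in> W 3" "h \<in> W 3" "pull \<theta> h = g"
  shows "conjugates \<theta> (Dmap \<circ>\<^sub>f time_one g) (Dmap \<circ>\<^sub>f time_one h)"
proof -
  note f = canonical_fixes[OF \<theta>(1)]
  note i = is_inverseD[OF \<theta>(2) f]
  have E: "pull \<theta> (exp_lie h u) = exp_lie g (pull \<theta> u)" for u
    by (rule shom_exp_lie[OF pull_shom[OF f] gh(2,1)])
      (simp add: lie_def canonical_poisson[OF \<theta>(1), symmetric] gh)
  have "Dmap \<circ>\<^sub>f time_one g = \<zeta> \<circ>\<^sub>f (Dmap \<circ>\<^sub>f time_one h) \<circ>\<^sub>f \<theta>"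
    by (rule pull_inject)
      (simp_all add: pull_conjugate pull_Dmap_time_one gh(1,2) i f E D)
  then show ?thesis using \<theta>(2) unfolding conjugates_def by blast
qed

lemma conjugate_normal_forms:
  assumes \<phi>: "canonical \<phi>" "canonical \<phi>'" and c: "conjugates \<phi> F (Dmap \<circ>\<^sub>f time_one h)"
    "conjugates \<phi>' F (Dmap \<circ>\<^sub>f time_one h')"
    and h: "h - h3 a \<in> W 4" "normal_shape (h - h3 a)"
    and h': "h' - h3 a' \<in> W 4" "normal_shape (h' - h3 a')"
  shows "h = h'"
proof -
  have nf: "k \<in> W 3 \<and> odd_in_x k" if "k - h3 a \<in> W 4" "normal_shape (k - h3 a)" for k a
  proof -
    have "odd_in_x (k - h3 a)" using that(2) by (auto simp: odd_in_x_cf normal_shape_def)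
    then show ?thesis
      using odd_in_x_simps(2)[OF _ h3_odd[of a]] wt_add[OF wt_mono[OF that(1), of 3] h3_wt[of a]]
      by fastforce
  qed
  have hw: "h \<in> W 3" "odd_in_x h" "h' \<in> W 3" "odd_in_x h'" using nf h h' by blast+
  obtain \<eta> \<eta>' where \<eta>: "is_inverse \<eta> \<phi>" "F = \<eta> \<circ>\<^sub>f (Dmap \<circ>\<^sub>f time_one h) \<circ>\<^sub>f \<phi>"
    and \<eta>': "is_inverse \<eta>' \<phi>'" "F = \<eta>' \<circ>\<^sub>f (Dmap \<circ>\<^sub>f time_one h') \<circ>\<^sub>f \<phi>'"
    using c unfolding conjugates_def by (elim exE conjE) (rule that)
  note f = canonical_fixes[OF \<phi>(1)] canonical_fixes[OF \<phi>(2)]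
  note i = is_inverseD[OF \<eta>(1) f(1)] is_inverseD[OF \<eta>'(1) f(2)]
  \<comment> \<open>The action of \<open>\<phi>'\<close> after \<open>\<eta>\<close>, the change of
    variables between the two normal forms.\<close>
  define T where "T = (\<lambda>f. pull \<eta> (pull \<phi>' f))"
  have shom: "shom T" unfolding T_def
    by (rule shom_compose[OF pull_shom[OF i(1)] pull_shom[OF f(2)]])
  have "poisson (pull \<eta> u) (pull \<eta> v) = pull \<eta> (poisson u v)" for u v
    using arg_cong[OF canonical_poisson[OF \<phi>(1), of "pull \<eta> u" "pull \<eta> v"], of "pull \<eta>"]
    by (simp add: i)
  then have Tp: "poisson (T u) (T v) = T (poisson u v)" for u v
    by (simp add: T_def canonical_poisson[OF \<phi>(2)])
  have surj: "T (pull \<eta>' (pull \<phi> u)) = u" for u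
    by (simp add: T_def i)
  have inter: "exp_lie h (pull Dmap (T u)) = T (exp_lie h' (pull Dmap u))" for u
  proof -
    have "pull F v = pull \<phi> (exp_lie h (pull Dmap (pull \<eta> v)))" for v
      unfolding \<eta>(2) by (simp add: pull_conjugate pull_Dmap_time_one f i hw)
    moreover have "pull F v = pull \<phi>' (exp_lie h' (pull Dmap (pull \<eta>' v)))" for v
      unfolding \<eta>'(2) by (simp add: pull_conjugate pull_Dmap_time_one f i hw)
    ultimately have "pull \<phi> (exp_lie h (pull Dmap (pull \<eta> (pull \<phi>' u)))) =
      pull \<phi>' (exp_lie h' (pull Dmap (pull \<eta>' (pull \<phi>' u))))" by metis
    then have "pull \<eta> (pull \<phi> (exp_lie h (pull Dmap (pull \<eta> (pull \<phi>' u))))) =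
      pull \<eta> (pull \<phi>' (exp_lie h' (pull Dmap (pull \<eta>' (pull \<phi>' u)))))" by simp
    then show ?thesis by (simp add: T_def i)
  qed
  define b where "b = T h'"
  have b: "b \<in> W 3" unfolding b_def by (rule shomD(5)[OF shom hw(3)])
  have TE: "T (exp_lie h' u) = exp_lie b (T u)" for u
    by (rule shom_exp_lie[OF shom hw(3) b]) (simp add: lie_def Tp b_def)
  \<comment> \<open>Squaring eliminates \<open>D\<close>, which commutes with the flows of the odd
    series \<open>h\<close> and \<open>h'\<close>; its commutation with \<open>T\<close> is still to
    be shown.\<close>
  have "exp_lie h (exp_lie h (T u)) = exp_lie b (exp_lie b (T u))" for u
  proof -
    have "exp_lie h (exp_lie h (T u)) = exp_lie h (pull Dmap (exp_lie h (pull Dmap (T u))))"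
      by (simp add: Dmap_exp_lie hw Dmap_Dmap)
    also have "\<dots> = T (exp_lie h' (exp_lie h' u))"
      by (simp add: inter Dmap_exp_lie hw Dmap_Dmap)
    finally show ?thesis by (simp add: TE)
  qed
  then have sq: "exp_lie h (exp_lie h u) = exp_lie b (exp_lie b u)" for u
    using surj by metis
  have pd: "pd_x (h - b) = 0" "pd_y (h - b) = 0"
    by (rule exp_lie_square_inject[OF hw(1) b sq])+
  \<comment> \<open>Equal gradients give equal Lie derivatives and flows; cancelling the flow in
    \<open>inter\<close> then shows that \<open>T\<close> commutes with \<open>D\<close>.\<close>
  have "lie h = lie b"
    using pd by (auto simp: lie_def poisson_def)
  then have E: "exp_lie h = exp_lie b" by (auto simp: exp_lie_def)
  have D: "pull Dmap (T u) = T (pull Dmap u)" for u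
  proof -
    have "exp_lie h (pull Dmap (T u)) = exp_lie h (T (pull Dmap u))"
      using inter[of u] by (simp add: TE E)
    then show ?thesis using exp_lie_inverse[OF hw(1)] by metis
  qed
  have "pull Dmap b = - b"
    using hw(4) by (simp add: b_def D odd_in_x_pull shom_simps[OF shom])
  then have odd: "odd_in_x (h - b)"
    by (intro odd_in_x_simps hw) (simp add: odd_in_x_pull)
  \<comment> \<open>A series odd in \<open>x\<close> is determined by its
    \<open>x\<close>-derivative.\<close>
  have "h - b = 0"
  proof (rule series_eqI)
    fix k l m
    show "cf (h - b) k l m = cf 0 k l m"
    proof (cases k)
      case 0
      then show ?thesis using odd unfolding odd_in_x_cf by simp
    next
      case (Suc k')
      have "cf (pd_x (h - b)) k' l m = 0" using pd(1) by simp
      then show ?thesis unfolding cf_pd_x using Suc by (simp del: of_nat_Suc)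
    qed
  qed
  then have Th: "T h' = h" by (simp add: b_def)
  have "poisson (T sX) (T sY) = 1"
    unfolding Tp by (simp add: poisson_def shom_simps[OF shom])
  from normal_form_unique[OF shom this D Th h h'] show ?thesis .
qed

section \<open>Existence\<close>

text \<open>Completeness of the filtration: a coefficient of weight \<open>w\<close> is read off at
  index \<open>w + 1\<close>, from which on it no longer changes.\<close>

lemma wt_limit:
  assumes s: "\<And>n. s (Suc n) - s n \<in> W (n + c)"
  obtains f where "\<And>n. f - s n \<in> W (n + c)"
proof -
  have mono: "s (n + d) - s n \<in> W (n + c)" for n d
  proof (induction d)
    case (Suc d)
    have "s (n + Suc d) - s (n + d) \<in> W (n + c)"
      using s[of "n + d"] by (auto intro: wt_mono)
    from wt_add[OF this Suc] show ?case by simp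
  qed simp
  define f where "f = mk_series (\<lambda>k l m. cf (s (Suc (k + l + 3 * m))) k l m)"
  have "f - s n \<in> W (n + c)" for n
  proof (rule wtI)
    fix k l m assume klm: "k + l + 3 * m < n + c"
    define N where "N = Suc (k + l + 3 * m)"
    have "cf (s N) k l m = cf (s n) k l m"
    proof (cases "n \<le> N")
      case True
      then have "s N - s n \<in> W (n + c)" using mono[of n "N - n"] by simp
      then show ?thesis using wtD[of "s N - s n" 3 "n + c"] klm by simp
    next
      case False
      then have "s n - s N \<in> W (N + c)" using mono[of N "n - N"] by simp
      then show ?thesis using wtD[of "s n - s N" 3 "N + c" k l m] by (simp add: N_def)
    qed
    then show "cf (f - s n) k l m = 0" by (simp add: f_def N_def)
  qed
  then show ?thesis by (rule that)
qed

text \<open>The homological equation splits the error into \<open>N + lie X (h3 a)\<close>; adding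
  \<open>X\<close> to the exponent and \<open>N\<close> to the Hamiltonian removes it up to one more
  weight. Adding \<open>X\<close> to \<open>\<chi>\<close>, instead of composing flows, makes the
  limit a single time-one map.\<close>

lemma normal_form_step:
  assumes g: "odd_in_x g" and \<chi>: "odd_in_x \<chi>" "\<chi> \<in> W 3" and h: "h - h3 a \<in> W 4" "odd_in_x h"
    and r: "g - exp_lie \<chi> h \<in> W (n + 4)"
  obtains X N where "odd_in_x X" "X \<in> W (n + 3)" "normal_shape N" "N \<in> W (n + 4)"
    "g - exp_lie (\<chi> + X) (h + N) \<in> W (Suc n + 4)"
proof -
  have hw: "h \<in> W 3"
    using wt_add[OF wt_mono[OF h(1), of 3] h3_wt[of a]] by simp
  define G where "G = g - exp_lie \<chi> h"
  have "odd_in_x G" "G \<in> W (Suc (n + 3))"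
    unfolding G_def using r by (auto intro!: odd_in_x_simps g odd_in_x_exp_lie \<chi> h simp: numeral_eq_Suc)
  then obtain X N where XN: "odd_in_x X" "X \<in> W (n + 3)" "normal_shape N" "N \<in> W (Suc (n + 3))"
    "G = N + lie X (h3 a)"
    by (rule homological_equation)
  define \<theta> where "\<theta> = \<chi> + X"
  have \<theta>: "\<theta> \<in> W 3" unfolding \<theta>_def by (intro wt_add \<chi> wt_mono[OF XN(2)]) simp
  have X: "lie X u \<in> W (v + (n + 1))" if "u \<in> W v" for u v
    using lie_wt[of X "n + 1" u v] XN(2) that by (simp add: numeral_eq_Suc)
  have 1: "exp_lie \<theta> h - exp_lie \<chi> h - lie X h \<in> W (n + 5)"
    using exp_lie_diff[OF \<chi>(2) \<theta> _ _ hw, of "n + 1"] X by (simp add: \<theta>_def add.commute)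
  have 2: "exp_lie \<theta> N - N \<in> W (n + 5)"
    using exp_lie_1[OF \<theta> XN(4)] by (simp add: numeral_eq_Suc)
  have 3: "lie X (h - h3 a) \<in> W (n + 5)"
    using X[OF h(1)] by (simp add: add.commute)
  have "g - exp_lie \<theta> (h + N) = G - (exp_lie \<theta> h - exp_lie \<chi> h) - exp_lie \<theta> N"
    by (simp add: G_def exp_lie_add[OF \<theta>])
  also have "\<dots> = - ((exp_lie \<theta> h - exp_lie \<chi> h - lie X h) + lie X (h - h3 a) + (exp_lie \<theta> N - N))"
    unfolding XN(5) by simp
  also have "\<dots> \<in> W (n + 5)" by (intro wt_uminus wt_add 1 2 3)
  finally show ?thesis
    using that[OF XN(1-3)] XN(4) by (simp add: \<theta>_def numeral_eq_Suc)
qed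

text \<open>Iterates \<open>normal_form_step\<close> from \<open>\<chi> = 0\<close> and
  \<open>h = h3 a\<close>. The increments recorded in \<open>Q\<close> make both sequences converge,
  and the limits inherit parity and shape coefficient by coefficient.\<close>

lemma normal_form_exists:
  assumes g: "odd_in_x g" "g - h3 a \<in> W 4"
  obtains \<chi> h where "odd_in_x \<chi>" "\<chi> \<in> W 3" "h - h3 a \<in> W 4" "normal_shape (h - h3 a)" "exp_lie \<chi> h = g"
proof -
  define P where "P = (\<lambda>n (\<chi>, h). odd_in_x \<chi> \<and> \<chi> \<in> W 3 \<and> h - h3 a \<in> W 4 \<and> normal_shape (h - h3 a) \<and>
    g - exp_lie \<chi> h \<in> W (n + 4))"
  define Q where "Q = (\<lambda>n (\<chi>, h) (\<chi>', h'). \<chi>' - \<chi> \<in> W (n + 3) \<and> h' - h \<in> W (n + 4))"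
  have odd: "odd_in_x h" if "normal_shape (h - h3 a)" for h
  proof -
    have "odd_in_x (h - h3 a)" using that by (auto simp: odd_in_x_cf normal_shape_def)
    from odd_in_x_simps(2)[OF this h3_odd[of a]] show ?thesis by simp
  qed
  have "\<exists>s. \<forall>n. P n (s n) \<and> Q n (s n) (s (Suc n))"
  proof (rule dependent_nat_choice[of P Q])
    have "exp_lie 0 (h3 a) = h3 a" by (rule exp_lie_fixed) (auto simp: lie_def poisson_simps)
    then have "P 0 (0, h3 a)"
      using g by (simp add: P_def odd_in_x_simps normal_shape_def)
    then show "\<exists>x. P 0 x" by blast
    fix x n assume P: "P n x"
    obtain \<chi> h where x: "x = (\<chi>, h)" by fastforce
    have p: "odd_in_x \<chi>" "\<chi> \<in> W 3" "h - h3 a \<in> W 4" "normal_shape (h - h3 a)" "g - exp_lie \<chi> h \<in> W (n + 4)"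
      using P by (auto simp: P_def x)
    obtain X N where XN: "odd_in_x X" "X \<in> W (n + 3)" "normal_shape N" "N \<in> W (n + 4)"
      "g - exp_lie (\<chi> + X) (h + N) \<in> W (Suc n + 4)"
      by (rule normal_form_step[OF g(1) p(1-3) odd[OF p(4)] p(5)])
    have "N + (h - h3 a) \<in> W 4"
      by (intro wt_add p wt_mono[OF XN(4)]) simp
    moreover have "normal_shape (N + (h - h3 a))"
      using p(4) XN(3) unfolding normal_shape_def by (metis add_0 cf_add)
    moreover have "\<chi> + X \<in> W 3"
      by (intro wt_add p wt_mono[OF XN(2)]) simp
    ultimately have "P (Suc n) (\<chi> + X, h + N)"
      using p XN by (simp add: P_def odd_in_x_simps algebra_simps)
    moreover have "Q n x (\<chi> + X, h + N)" using XN by (simp add: Q_def x)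
    ultimately show "\<exists>y. P (Suc n) y \<and> Q n x y" by blast
  qed
  then obtain s where s: "\<And>n. P n (s n)" "\<And>n. Q n (s n) (s (Suc n))" by blast
  define c h where "c = (\<lambda>n. fst (s n))" and "h = (\<lambda>n. snd (s n))"
  have p: "odd_in_x (c n)" "c n \<in> W 3" "h n - h3 a \<in> W 4" "normal_shape (h n - h3 a)"
    "g - exp_lie (c n) (h n) \<in> W (n + 4)" for n
    using s(1)[of n] by (simp_all add: P_def c_def h_def split: prod.splits)
  have q: "c (Suc n) - c n \<in> W (n + 3)" "h (Suc n) - h n \<in> W (n + 4)" for n
    using s(2)[of n] by (simp_all add: Q_def c_def h_def split: prod.splits)
  obtain \<chi> where \<chi>: "\<And>n. \<chi> - c n \<in> W (n + 3)" using wt_limit[of c, OF q(1)] by blast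
  obtain k where k: "\<And>n. k - h n \<in> W (n + 4)" using wt_limit[of h, OF q(2)] by blast
  have cf: "cf \<chi> i j m = cf (c (i + j + 3 * m)) i j m" "cf k i j m = cf (h (i + j + 3 * m)) i j m" for i j m
    using wtD[OF \<chi>[of "i + j + 3 * m"], of i j m] wtD[OF k[of "i + j + 3 * m"], of i j m] by simp_all
  have odd_\<chi>: "odd_in_x \<chi>" using p(1) by (simp add: odd_in_x_cf cf)
  have \<chi>3: "\<chi> \<in> W 3" using wt_add[OF \<chi>[of 0, unfolded add_0] p(2)[of 0]] by simp
  have k4: "k - h3 a \<in> W 4" using wt_add[OF k[of 0, unfolded add_0] p(3)[of 0]] by simp
  have shape: "normal_shape (k - h3 a)"
    using p(4) unfolding normal_shape_def cf_diff cf(2) by blast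
  \<comment> \<open>Replacing \<open>c n\<close> and \<open>h n\<close> by their limits changes the
    exponential only in weight at least \<open>n\<close>.\<close>
  have "g - exp_lie \<chi> k \<in> W n" for n
  proof -
    note E = exp_lie_shom[OF p(2)[of n]]
    have L: "lie (\<chi> - c n) u \<in> W (v + (n + 1))" if "u \<in> W v" for u v
      using lie_wt[of "\<chi> - c n" "n + 1" u v] \<chi>[of n] that by (simp add: numeral_eq_Suc)
    have "exp_lie \<chi> k - exp_lie (c n) k - lie (\<chi> - c n) k \<in> W (0 + (n + 1) + 1)"
      by (rule exp_lie_diff[OF p(2) \<chi>3 _ L]) auto
    then have 1: "exp_lie \<chi> k - exp_lie (c n) k - lie (\<chi> - c n) k \<in> W n"
      by (rule wt_mono) simp
    have 2: "lie (\<chi> - c n) k \<in> W n"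
      using L[OF wt_zero, of k] by (rule wt_mono) simp
    have 3: "exp_lie (c n) (k - h n) \<in> W n"
      using exp_lie_wt[OF p(2) k[of n], of n] by (rule wt_mono) simp
    have 4: "g - exp_lie (c n) (h n) \<in> W n"
      using p(5)[of n] by (rule wt_mono) simp
    have "g - exp_lie \<chi> k = (g - exp_lie (c n) (h n)) - exp_lie (c n) (k - h n)
      - (exp_lie \<chi> k - exp_lie (c n) k - lie (\<chi> - c n) k) - lie (\<chi> - c n) k"
      by (simp add: shom_simps[OF E])
    also have "\<dots> \<in> W n" by (rule wt_diff[OF wt_diff[OF wt_diff[OF 4 3] 1] 2])
    finally show ?thesis .
  qed
  then have "g - exp_lie \<chi> k = 0" by (rule wt_eq_0)
  then have "exp_lie \<chi> k = g" by simp
  from that[OF odd_\<chi> \<chi>3 k4 shape this] show ?thesis .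
qed

lemma diag_canonical:
  assumes "t \<noteq> 0"
  shows "canonical (diag t (1 / t))" "is_inverse (diag (1 / t) t) (diag t (1 / t))"
proof -
  have "sconst t * sconst (1 / t) = 1"
    using assms by (simp add: sconst_simps(5)[symmetric] del: sconst_simps(5))
  then show "canonical (diag t (1 / t))"
    by (intro canonicalI diag(1)) (simp add: diag poisson_def mult.assoc)
  show "is_inverse (diag (1 / t) t) (diag t (1 / t))"
    using assms by (intro is_inverseI diag(1) series_eqI) (simp_all add: cf_diag power_divide)
qed

lemma diag_normalizes:
  assumes g: "g \<in> W 3" "odd_in_x g" and b: "cf g 1 2 0 \<noteq> 0"
  obtains t a where "t \<noteq> 0" "odd_in_x (pull (diag (1 / t) t) g)" "pull (diag (1 / t) t) g - h3 a \<in> W 4"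
proof -
  \<comment> \<open>The substitution of \<open>x / t\<close> and \<open>t y\<close> multiplies the
    coefficient of \<open>x y^2\<close> by \<open>t\<close>, making it one.\<close>
  define t where "t = 1 / cf g 1 2 0"
  let ?g = "pull (diag (1 / t) t) g"
  have t: "t \<noteq> 0" using b by (simp add: t_def)
  have "odd_in_x ?g" using g(2) by (simp add: odd_in_x_cf cf_diag)
  moreover have "?g - h3 (cf ?g 3 0 0) \<in> W 4"
  proof (rule wtI)
    fix k l m :: nat assume "k + l + 3 * m < 4"
    \<comment> \<open>Weight three consists of the cubic monomials in \<open>x\<close>,
      \<open>y\<close> and of \<open>\<epsilon>\<close>; oddness leaves \<open>x y^2\<close> and
      \<open>x^3\<close>, the terms of \<open>h3\<close>.\<close>
    then consider "k + l + 3 * m < 3" | "m = 0" "k + l = 3" | "m = 1" "k = 0" "l = 0"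
      by (cases m; cases "k + l + 3 * m < 3") auto
    then show "cf (?g - h3 (cf ?g 3 0 0)) k l m = 0"
    proof cases
      case 1
      then show ?thesis using wtD[OF g(1)] by (auto simp: cf_diag cf_h3)
    next
      case 2
      then consider "k = 0" "l = 3" | "k = 1" "l = 2" | "k = 2" "l = 1" | "k = 3" "l = 0" by linarith
      then show ?thesis
        using g(2) 2(1) b by cases (auto simp: odd_in_x_cf cf_diag cf_h3 t_def power2_eq_square field_simps)
    next
      case 3
      then show ?thesis using g(2) by (simp add: odd_in_x_cf cf_diag cf_h3)
    qed
  qed
  ultimately show ?thesis using that t by blast
qed

theorem theorem5:
  fixes F :: fmap
  assumes "analytic_family F \<or> smooth_family F \<or> formal_family F"
    and "fixes_origin F"
    and "has_eigenvalue (lin_part F) (-1)" and "has_eigenvalue (lin_part F) 1"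
    and "nondegenerate F"
  shows "(\<exists>\<phi> a A B. brings_to_normal_form \<phi> F a A B) \<and>
    (\<forall>\<phi> a A B \<phi>' a' A' B'.
       brings_to_normal_form \<phi> F a A B \<longrightarrow> brings_to_normal_form \<phi>' F a' A' B' \<longrightarrow>
       normal_ham a A B = normal_ham a' A' B' \<and> a = a' \<and> A = A' \<and> B = B')"
proof (intro conjI)
  obtain \<psi> g b c where \<psi>: "canonical \<psi>" "conjugates \<psi> F (Dmap \<circ>\<^sub>f time_one g)"
    and g: "g \<in> W 3" "odd_in_x g" and b: "b \<noteq> 0"
    and cubic: "cf g 1 2 0 = cf (sconst b * sX * sY ^ 2 + sconst c * sX ^ 3) 1 2 0"
    using assms(5) unfolding nondegenerate_def order_ge3_iff by fastforce
  have "sconst b * sX * sY ^ 2 + sconst c * sX ^ 3 = sconst b * mon 1 2 0 + sconst c * mon 3 0 0"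
    by (simp add: mon_def mult.assoc)
  then have "cf g 1 2 0 \<noteq> 0" using cubic b by (simp add: cf_mon)
  then obtain t a where t: "t \<noteq> 0" and odd: "odd_in_x (pull (diag (1 / t) t) g)"
    and lead: "pull (diag (1 / t) t) g - h3 a \<in> W 4"
    by (rule diag_normalizes[OF g])
  define g1 where "g1 = pull (diag (1 / t) t) g"
  \<comment> \<open>The inverse scaling: pulling \<open>g1\<close> back along it returns
    \<open>g\<close>, the direction that \<open>conjugates_time_one\<close> requires.\<close>
  define \<theta> where "\<theta> = diag t (1 / t)"
  have g1: "g1 \<in> W 3" unfolding g1_def by (rule shomD(5)[OF pull_shom[OF diag(1)] g(1)])
  have "pull \<theta> g1 = g"
    unfolding \<theta>_def g1_def by (rule is_inverseD(3)[OF diag_canonical(2)[OF t] diag(1)])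
  then have c1: "conjugates \<theta> (Dmap \<circ>\<^sub>f time_one g) (Dmap \<circ>\<^sub>f time_one g1)"
    unfolding \<theta>_def using g g1
    by (intro conjugates_time_one[OF diag_canonical[OF t]]) (auto intro!: series_eqI simp: cf_diag cf_Dmap)
  obtain \<chi> h where \<chi>: "odd_in_x \<chi>" "\<chi> \<in> W 3" and h: "h - h3 a \<in> W 4" "normal_shape (h - h3 a)"
    and eg: "exp_lie \<chi> h = g1"
    unfolding g1_def by (rule normal_form_exists[OF odd lead])
  have hw: "h \<in> W 3"
    using wt_add[OF wt_mono[OF h(1), of 3] h3_wt[of a]] by simp
  have c2: "conjugates (time_one \<chi>) (Dmap \<circ>\<^sub>f time_one g1) (Dmap \<circ>\<^sub>f time_one h)"
    using time_one[OF \<chi>(2)] time_one_inverse[OF \<chi>(2)] g1 hw eg \<chi>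
    by (intro conjugates_time_one) (auto simp: Dmap_exp_lie)
  obtain A B where AB: "A_form A" "B_form B" "h = normal_ham a A B"
    by (rule normal_shape_ham[OF h])
  have can: "canonical \<theta>" unfolding \<theta>_def by (rule diag_canonical[OF t])
  note fo = canonical_fixes[OF can] canonical_fixes[OF \<psi>(1)] time_one(1)[OF \<chi>(2)]
    pull_Dmap_time_one(1)[OF g1] pull_Dmap_time_one(1)[OF hw]
  have "conjugates (\<theta> \<circ>\<^sub>f \<psi>) F (Dmap \<circ>\<^sub>f time_one g1)"
    by (rule conjugates_trans[OF \<psi>(2) c1]) (intro fo)+
  then have "conjugates (time_one \<chi> \<circ>\<^sub>f (\<theta> \<circ>\<^sub>f \<psi>)) F (Dmap \<circ>\<^sub>f time_one h)"
    by (rule conjugates_trans[OF _ c2]) (intro fo pull_fcomp)+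
  moreover have "canonical (time_one \<chi> \<circ>\<^sub>f (\<theta> \<circ>\<^sub>f \<psi>))"
    by (intro canonical_fcomp time_one(3) \<chi> can \<psi>)
  ultimately show "\<exists>\<phi> a A B. brings_to_normal_form \<phi> F a A B"
    using AB unfolding brings_to_normal_form_def by blast
next
  show "\<forall>\<phi> a A B \<phi>' a' A' B'.
       brings_to_normal_form \<phi> F a A B \<longrightarrow> brings_to_normal_form \<phi>' F a' A' B' \<longrightarrow>
       normal_ham a A B = normal_ham a' A' B' \<and> a = a' \<and> A = A' \<and> B = B'"
  proof (intro allI impI)
    fix \<phi> a A B \<phi>' a' A' B'
    assume 1: "brings_to_normal_form \<phi> F a A B" and 2: "brings_to_normal_form \<phi>' F a' A' B'"
    have "normal_ham a A B = normal_ham a' A' B'"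
      using 1 2 unfolding brings_to_normal_form_def
      by (intro conjugate_normal_forms[of \<phi> \<phi>' F _ _ a a'] normal_ham_shape) auto
    moreover from this have "a = a' \<and> A = A' \<and> B = B'"
      using 1 2 unfolding brings_to_normal_form_def by (intro normal_ham_inject) auto
    ultimately show "normal_ham a A B = normal_ham a' A' B' \<and> a = a' \<and> A = A' \<and> B = B'" by simp
  qed
qed

end
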